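(* Consider the recurrence entanglement distillation algorithm described in the context, run on qubit pairs each initially in a state $$\rho=\tfrac12\big(|ab\rangle\langle ab|+e^{-\imath\alpha}R^{\dagger}|ab\rangle\langle a'b'|+e^{\imath\alpha}R\,|a'b'\rangle\langle ab|+|a'b'\rangle\langle a'b'|\big),$$ where $\{|a\rangle,|a'\rangle\}$ and $\{|b\rangle,|b'\rangle\}$ are orthonormal bases of $\mathbb{C}^2$, $\alpha\in[0,2\pi)$, $R\in\mathbb{C}$, $0<|R|\le1$. Let $\rho^{(0)}$ be the state of each pair after local state preparation and, for $k\ge1$, let $\rho^{(k)}$ be the state of a pair kept in round $k$, $F_k$ its fidelity with respect to $|\Phi^+\rangle$, and $P_k$ the probability that the source pair is kept in round $k$. Then for every $k\ge1$ the state $\rho^{(k-1)}$ belongs to the set $\mathcal{S}$, and the algorithm achieves in round $k$ the optimal fidelity and the corresponding optimal success probability: $$F_k=F^*(\rho^{(k-1)}),\qquad P_k=P^*(\rho^{(k-1)}).$$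
   Context: Notation: $\dagger$ denotes Hermitian transpose (complex conjugation for scalars), $\imath$ is the imaginary unit, $\{|0\rangle,|1\rangle\}$ is the computational basis of $\mathbb{C}^2$, $|\Phi^+\rangle=\frac1{\sqrt2}(|00\rangle+|11\rangle)$; in $|xy\rangle=|x\rangle\otimes|y\rangle$ the first factor is held by node Alice (A) and the second by node Bob (B). The fidelity of a two-qubit state $\sigma$ is $\langle\Phi^+|\sigma|\Phi^+\rangle$. $\mathcal{S}$ is the set of all two-qubit density matrices of the form $\frac12\big(|ab\rangle\langle ab|+e^{-\imath\alpha}R^{\dagger}|ab\rangle\langle a'b'|+e^{\imath\alpha}R|a'b'\rangle\langle ab|+|a'b'\rangle\langle a'b'|\big)$ for some orthonormal bases $\{|a\rangle,|a'\rangle\}$, $\{|b\rangle,|b'\rangle\}$ of $\mathbb{C}^2$, some $\alpha\in[0,2\pi)$ and some $R\in\mathbb{C}$ with $|R|\in[0,1]$. Optimal quantities. For a two-qubit state $\sigma$, Alice and Bob hold two pairs in joint state $\sigma^{\mathrm J}=\sigma\otimes\sigma$; the first pair is qubits 1 and 2, the second is qubits 3 and 4; Alice holds qubits 1 and 3, Bob holds 2 and 4. A distillation operation $\mathcal{D}$ is a quantum operation (completely positive, trace-non-increasing map) on the four qubits, describing the "success" outcome, implementable by local operations and classical communication (LOCC). Its success probability is $P_{\mathcal{D}}(\sigma)=\mathrm{tr}\{\mathcal{D}\{\sigma^{\mathrm J}\}\}$ and, when this is nonzero, its output fidelity is $$F_{\mathcal{D}}(\sigma)=\langle\Phi^+|\,\frac{\mathrm{tr}_{3,4}\{\mathcal{D}\{\sigma^{\mathrm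 J}\}\}}{\mathrm{tr}\{\mathcal{D}\{\sigma^{\mathrm J}\}\}}\,|\Phi^+\rangle.$$ $F^*(\sigma)=\max_{\mathcal{D}}F_{\mathcal{D}}(\sigma)$, and $P^*(\sigma)$ is the maximum of $P_{\mathcal{D}}(\sigma)$ over those $\mathcal{D}$ with $F_{\mathcal{D}}(\sigma)=F^*(\sigma)$. Algorithm. Let $\theta=\alpha+\mathrm{Phase}\{R\}$. Local state preparation: on each qubit pair, Alice and Bob apply the local unitaries $$U_{\mathrm A}=\frac{|0\rangle+|1\rangle}{\sqrt2}\langle a|+\frac{|0\rangle-|1\rangle}{\sqrt2}\langle a'|,\qquad U_{\mathrm B}=\frac{|0\rangle+|1\rangle}{\sqrt2}\langle b|+e^{-\imath\theta}\frac{|0\rangle-|1\rangle}{\sqrt2}\langle b'|,$$ so that the state of each pair becomes $\rho^{(0)}=(U_{\mathrm A}\otimes U_{\mathrm B})\rho(U_{\mathrm A}\otimes U_{\mathrm B})^\dagger$. Round $k$ ($k=1,2,\dots$): take two kept qubit pairs, each in the state $\rho^{(k-1)}$ (joint state $\rho^{(k-1)}\otimes\rho^{(k-1)}$); call the first the source pair and the second the target pair. (i) Each node applies the CNOT gate $|00\rangle\langle00|+|01\rangle\langle01|+|10\rangle\langle11|+|11\rangle\langle10|$ to its two qubits, with its qubit of the source pair as first (control) qubit and its qubit of the target pair as second (target) qubit. (ii) Each node measures its qubit of the target pair with the operators $|0\rangle\langle0|,|1\rangle\langle1|$, and the results are exchanged. (iii) If the two results agree, the source pair is kept; otherwise it is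 discarded. $\rho^{(k)}$ is the density matrix of the source pair conditional on being kept. *)

theory Defs
  imports Complex_Main "Jordan_Normal_Form.Schur_Decomposition"
begin

section \<open>Linear algebra\<close>

text \<open>
  Basis vectors of a tensor product are ordered lexicographically, so that the basis vector
  \<open>|x\<^sub>1 \<dots> x\<^sub>n\<rangle>\<close> of \<open>n\<close> qubits has the index with binary expansion \<open>x\<^sub>1 \<dots> x\<^sub>n\<close>.
  Note that \<open>v \<bullet>c u\<close> conjugates its second argument, i.e. it is the bracket \<open>\<langle>u|v\<rangle>\<close>.
\<close>

definition tensor_vec :: "complex vec \<Rightarrow> complex vec \<Rightarrow> complex vec" (infixr "\<otimes>\<^sub>v" 72) where
  "u \<otimes>\<^sub>v v = vec (dim_vec u * dim_vec v) (\<lambda>i. u $ (i div dim_vec v) * v $ (i mod dim_vec v))"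

definition tensor_mat :: "complex mat \<Rightarrow> complex mat \<Rightarrow> complex mat" (infixr "\<otimes>\<^sub>m" 72) where
  "A \<otimes>\<^sub>m B = mat (dim_row A * dim_row B) (dim_col A * dim_col B)
     (\<lambda>(i, j). A $$ (i div dim_row B, j div dim_col B) * B $$ (i mod dim_row B, j mod dim_col B))"

definition ketbra :: "complex vec \<Rightarrow> complex vec \<Rightarrow> complex mat" where
  "ketbra u v = mat (dim_vec u) (dim_vec v) (\<lambda>(i, j). u $ i * cnj (v $ j))"

definition tr :: "complex mat \<Rightarrow> complex" where
  "tr M = (\<Sum>i<dim_row M. M $$ (i, i))"

text \<open>Matrices of all sizes share one type, which has no zero; hence sums carry the size.\<close>

definition msum :: "nat \<Rightarrow> nat \<Rightarrow> complex mat list \<Rightarrow> complex mat" where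
  "msum m n Ms = mat m n (\<lambda>ij. \<Sum>M\<leftarrow>Ms. M $$ ij)"

text \<open>The order on \<^typ>\<open>complex\<close> makes \<open>0 \<le> z\<close> include that \<open>z\<close> is real.\<close>

definition psd :: "nat \<Rightarrow> complex mat \<Rightarrow> bool" where
  "psd n M \<longleftrightarrow> M \<in> carrier_mat n n \<and> (\<forall>v \<in> carrier_vec n. 0 \<le> (M *\<^sub>v v) \<bullet>c v)"

definition density :: "nat \<Rightarrow> complex mat \<Rightarrow> bool" where
  "density n M \<longleftrightarrow> psd n M \<and> tr M = 1"

definition orthonormal_basis2 :: "complex vec \<Rightarrow> complex vec \<Rightarrow> bool" where
  "orthonormal_basis2 u v \<longleftrightarrow> u \<in> carrier_vec 2 \<and> v \<in> carrier_vec 2 \<and>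
     u \<bullet>c u = 1 \<and> v \<bullet>c v = 1 \<and> u \<bullet>c v = 0"


section \<open>Qubits\<close>

definition ket :: "nat \<Rightarrow> complex vec" where
  "ket x = unit_vec 2 x"

definition ket_plus :: "complex vec" where
  "ket_plus = complex_of_real (1 / sqrt 2) \<cdot>\<^sub>v (ket 0 + ket 1)"

definition ket_minus :: "complex vec" where
  "ket_minus = complex_of_real (1 / sqrt 2) \<cdot>\<^sub>v (ket 0 - ket 1)"

definition Phi_plus :: "complex vec" where
  "Phi_plus = complex_of_real (1 / sqrt 2) \<cdot>\<^sub>v (ket 0 \<otimes>\<^sub>v ket 0 + ket 1 \<otimes>\<^sub>v ket 1)"

definition fidelity :: "complex mat \<Rightarrow> real" where
  "fidelity \<sigma> = Re ((\<sigma> *\<^sub>v Phi_plus) \<bullet>c Phi_plus)"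

definition cnot :: "complex mat" where
  "cnot = ketbra (ket 0 \<otimes>\<^sub>v ket 0) (ket 0 \<otimes>\<^sub>v ket 0) + ketbra (ket 0 \<otimes>\<^sub>v ket 1) (ket 0 \<otimes>\<^sub>v ket 1)
        + ketbra (ket 1 \<otimes>\<^sub>v ket 0) (ket 1 \<otimes>\<^sub>v ket 1) + ketbra (ket 1 \<otimes>\<^sub>v ket 1) (ket 1 \<otimes>\<^sub>v ket 0)"

definition swap :: "complex mat" where
  "swap = msum 4 4 [ketbra (ket y \<otimes>\<^sub>v ket x) (ket x \<otimes>\<^sub>v ket y). x \<leftarrow> [0, 1], y \<leftarrow> [0, 1]]"

text \<open>
  Four-qubit operators are written in the qubit order 1, 2, 3, 4, in which Alice holds 1, 3 and
  Bob holds 2, 4. The involution \<open>regroup\<close> exchanges qubits 2 and 3 and thus leads to the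
  node-wise order (1, 3), (2, 4).
\<close>

definition regroup :: "complex mat" where
  "regroup = 1\<^sub>m 2 \<otimes>\<^sub>m swap \<otimes>\<^sub>m 1\<^sub>m 2"

definition nodewise :: "complex mat \<Rightarrow> complex mat \<Rightarrow> complex mat" where
  "nodewise A B = regroup * (A \<otimes>\<^sub>m B) * regroup"

definition ptrace34 :: "complex mat \<Rightarrow> complex mat" where
  "ptrace34 X = mat 4 4 (\<lambda>(i, j). \<Sum>k<4. X $$ (i * 4 + k, j * 4 + k))"


section \<open>The set of states\<close>

definition two_kraus_state ::
  "complex vec \<Rightarrow> complex vec \<Rightarrow> complex vec \<Rightarrow> complex vec \<Rightarrow> real \<Rightarrow> complex \<Rightarrow> complex mat" where
  "two_kraus_state a a' b b' \<alpha> R = (1/2) \<cdot>\<^sub>m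
     (ketbra (a \<otimes>\<^sub>v b) (a \<otimes>\<^sub>v b)
      + (cis (- \<alpha>) * cnj R) \<cdot>\<^sub>m ketbra (a \<otimes>\<^sub>v b) (a' \<otimes>\<^sub>v b')
      + (cis \<alpha> * R) \<cdot>\<^sub>m ketbra (a' \<otimes>\<^sub>v b') (a \<otimes>\<^sub>v b)
      + ketbra (a' \<otimes>\<^sub>v b') (a' \<otimes>\<^sub>v b'))"

definition two_kraus_states :: "complex mat set" where
  "two_kraus_states = {\<sigma>. density 4 \<sigma> \<and> (\<exists>a a' b b' \<alpha> R.
     orthonormal_basis2 a a' \<and> orthonormal_basis2 b b' \<and> 0 \<le> \<alpha> \<and> \<alpha> < 2 * pi \<and> cmod R \<le> 1 \<and>
     \<sigma> = two_kraus_state a a' b b' \<alpha> R)}"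


section \<open>Quantum operations\<close>

text \<open>
  \<open>ampliate n m D\<close> is \<open>D \<otimes> id\<close>, where \<open>D\<close> acts on an \<open>n\<close>-dimensional system and the identity
  on an \<open>m\<close>-dimensional ancilla, which is the second tensor factor.
\<close>

definition ampliate ::
  "nat \<Rightarrow> nat \<Rightarrow> (complex mat \<Rightarrow> complex mat) \<Rightarrow> complex mat \<Rightarrow> complex mat" where
  "ampliate n m D X = mat (n * m) (n * m) (\<lambda>(i, j).
     D (mat n n (\<lambda>(s, t). X $$ (s * m + i mod m, t * m + j mod m))) $$ (i div m, j div m))"

definition linear_map_mat :: "nat \<Rightarrow> (complex mat \<Rightarrow> complex mat) \<Rightarrow> bool" where
  "linear_map_mat n D \<longleftrightarrow>
     (\<forall>X \<in> carrier_mat n n. D X \<in> carrier_mat n n) \<and>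
     (\<forall>X \<in> carrier_mat n n. \<forall>Y \<in> carrier_mat n n. D (X + Y) = D X + D Y) \<and>
     (\<forall>c. \<forall>X \<in> carrier_mat n n. D (c \<cdot>\<^sub>m X) = c \<cdot>\<^sub>m D X)"

definition completely_positive :: "nat \<Rightarrow> (complex mat \<Rightarrow> complex mat) \<Rightarrow> bool" where
  "completely_positive n D \<longleftrightarrow> (\<forall>m X. psd (n * m) X \<longrightarrow> psd (n * m) (ampliate n m D X))"

definition trace_nonincreasing :: "nat \<Rightarrow> (complex mat \<Rightarrow> complex mat) \<Rightarrow> bool" where
  "trace_nonincreasing n D \<longleftrightarrow> (\<forall>X. psd n X \<longrightarrow> Re (tr (D X)) \<le> Re (tr X))"

definition quantum_operation :: "nat \<Rightarrow> (complex mat \<Rightarrow> complex mat) \<Rightarrow> bool" where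
  "quantum_operation n D \<longleftrightarrow>
     linear_map_mat n D \<and> completely_positive n D \<and> trace_nonincreasing n D"


section \<open>Local operations and classical communication\<close>

text \<open>
  A finite-round LOCC protocol is a tree. At an inner node one of the two parties applies a local
  measurement given by its Kraus operators; the party announces the outcome, and the protocol goes
  on with the subtree of that outcome. A leaf tells whether the run is declared a success. Limits of
  protocols with an unbounded number of rounds are not included.

  A Kraus operator may change the dimension of the party's system, which covers ancillas being
  added or discarded. Operations with several Kraus operators per outcome, outcomes that are
  forgotten and outcomes that are not announced are covered by using the same continuation in
  several branches; local or shared randomness is covered by Kraus operators proportional to
  the identity.
\<close>

datatype locc_protocol =
    Stop bool
  | Alice "(complex mat \<times> locc_protocol) list"
  | Bob "(complex mat \<times> locc_protocol) list"

text \<open>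
  The parameters \<open>dA\<close>, \<open>dB\<close> are the current dimensions of the two systems. A successful run has to
  end with two qubits in the hands of each party.
\<close>

fun locc_wf :: "locc_protocol \<Rightarrow> nat \<Rightarrow> nat \<Rightarrow> bool" where
  "locc_wf (Stop success) dA dB \<longleftrightarrow> (success \<longrightarrow> dA = 4 \<and> dB = 4)"
| "locc_wf (Alice br) dA dB \<longleftrightarrow>
     msum dA dA (map (\<lambda>(K, p). mat_adjoint K * K) br) = 1\<^sub>m dA \<and>
     (\<forall>(K, p) \<in> set br. dim_col K = dA \<and> locc_wf p (dim_row K) dB)"
| "locc_wf (Bob br) dA dB \<longleftrightarrow>
     msum dB dB (map (\<lambda>(K, p). mat_adjoint K * K) br) = 1\<^sub>m dB \<and>
     (\<forall>(K, p) \<in> set br. dim_col K = dB \<and> locc_wf p dA (dim_row K))"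

text \<open>
  The unnormalized final state, summed over all successful runs, when the state of the joint system
  (Alice's factor first) is \<open>X\<close>.
\<close>

fun locc_run :: "locc_protocol \<Rightarrow> nat \<Rightarrow> nat \<Rightarrow> complex mat \<Rightarrow> complex mat" where
  "locc_run (Stop success) dA dB X = (if success then X else 0\<^sub>m 16 16)"
| "locc_run (Alice br) dA dB X = msum 16 16 (map (\<lambda>(K, p).
     locc_run p (dim_row K) dB ((K \<otimes>\<^sub>m 1\<^sub>m dB) * X * mat_adjoint (K \<otimes>\<^sub>m 1\<^sub>m dB))) br)"
| "locc_run (Bob br) dA dB X = msum 16 16 (map (\<lambda>(K, p).
     locc_run p dA (dim_row K) ((1\<^sub>m dA \<otimes>\<^sub>m K) * X * mat_adjoint (1\<^sub>m dA \<otimes>\<^sub>m K))) br)"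

definition locc_implementable :: "(complex mat \<Rightarrow> complex mat) \<Rightarrow> bool" where
  "locc_implementable D \<longleftrightarrow> (\<exists>p. locc_wf p 4 4 \<and>
     (\<forall>X \<in> carrier_mat 16 16. D X = regroup * locc_run p 4 4 (regroup * X * regroup) * regroup))"


section \<open>Optimal fidelity and success probability\<close>

definition distillation_op :: "(complex mat \<Rightarrow> complex mat) \<Rightarrow> bool" where
  "distillation_op D \<longleftrightarrow> quantum_operation 16 D \<and> locc_implementable D"

definition success_prob :: "(complex mat \<Rightarrow> complex mat) \<Rightarrow> complex mat \<Rightarrow> real" where
  "success_prob D \<sigma> = Re (tr (D (\<sigma> \<otimes>\<^sub>m \<sigma>)))"

definition output_fidelity :: "(complex mat \<Rightarrow> complex mat) \<Rightarrow> complex mat \<Rightarrow> real" where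
  "output_fidelity D \<sigma> =
     fidelity ((1 / tr (D (\<sigma> \<otimes>\<^sub>m \<sigma>))) \<cdot>\<^sub>m ptrace34 (D (\<sigma> \<otimes>\<^sub>m \<sigma>)))"

definition has_max :: "real set \<Rightarrow> bool" where
  "has_max X \<longleftrightarrow> (\<exists>m \<in> X. \<forall>x \<in> X. x \<le> m)"

text \<open>\<open>max_of X\<close> is the maximum of \<open>X\<close> if there is one, and unspecified otherwise.\<close>

definition max_of :: "real set \<Rightarrow> real" where
  "max_of X = (GREATEST m. m \<in> X)"

definition fidelities :: "complex mat \<Rightarrow> real set" where
  "fidelities \<sigma> = {output_fidelity D \<sigma> | D. distillation_op D \<and> success_prob D \<sigma> \<noteq> 0}"

definition optimal_fidelity :: "complex mat \<Rightarrow> real" where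
  "optimal_fidelity \<sigma> = max_of (fidelities \<sigma>)"

definition optimal_fidelity_probs :: "complex mat \<Rightarrow> real set" where
  "optimal_fidelity_probs \<sigma> = {success_prob D \<sigma> | D. distillation_op D \<and> success_prob D \<sigma> \<noteq> 0 \<and>
     output_fidelity D \<sigma> = optimal_fidelity \<sigma>}"

definition optimal_prob :: "complex mat \<Rightarrow> real" where
  "optimal_prob \<sigma> = max_of (optimal_fidelity_probs \<sigma>)"


section \<open>The algorithm\<close>

definition prep_A :: "complex vec \<Rightarrow> complex vec \<Rightarrow> complex mat" where
  "prep_A a a' = ketbra ket_plus a + ketbra ket_minus a'"

definition prep_B :: "complex vec \<Rightarrow> complex vec \<Rightarrow> real \<Rightarrow> complex mat" where
  "prep_B b b' \<theta> = ketbra ket_plus b + cis (- \<theta>) \<cdot>\<^sub>m ketbra ket_minus b'"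

definition prepared_state ::
  "complex vec \<Rightarrow> complex vec \<Rightarrow> complex vec \<Rightarrow> complex vec \<Rightarrow> real \<Rightarrow> complex \<Rightarrow> complex mat" where
  "prepared_state a a' b b' \<alpha> R =
     (let U = prep_A a a' \<otimes>\<^sub>m prep_B b b' (\<alpha> + Arg R)
      in U * two_kraus_state a a' b b' \<alpha> R * mat_adjoint U)"

text \<open>Source pair: qubits 1 and 2; target pair: qubits 3 and 4.\<close>

definition after_cnots :: "complex mat \<Rightarrow> complex mat" where
  "after_cnots \<sigma> = nodewise cnot cnot * (\<sigma> \<otimes>\<^sub>m \<sigma>) * mat_adjoint (nodewise cnot cnot)"

definition outcome_proj :: "nat \<Rightarrow> nat \<Rightarrow> complex mat" where
  "outcome_proj x y = 1\<^sub>m 4 \<otimes>\<^sub>m ketbra (ket x) (ket x) \<otimes>\<^sub>m ketbra (ket y) (ket y)"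

text \<open>The unnormalized joint state after the measurements, restricted to agreeing results.\<close>

definition agreeing_part :: "complex mat \<Rightarrow> complex mat" where
  "agreeing_part \<sigma> = msum 16 16
     [outcome_proj x x * after_cnots \<sigma> * mat_adjoint (outcome_proj x x). x \<leftarrow> [0, 1]]"

definition keep_prob :: "complex mat \<Rightarrow> real" where
  "keep_prob \<sigma> = Re (tr (agreeing_part \<sigma>))"

definition kept_state :: "complex mat \<Rightarrow> complex mat" where
  "kept_state \<sigma> = (1 / tr (agreeing_part \<sigma>)) \<cdot>\<^sub>m ptrace34 (agreeing_part \<sigma>)"

primrec pair_state ::
  "complex vec \<Rightarrow> complex vec \<Rightarrow> complex vec \<Rightarrow> complex vec \<Rightarrow> real \<Rightarrow> complex \<Rightarrow> nat \<Rightarrow> complex mat" where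
  "pair_state a a' b b' \<alpha> R 0 = prepared_state a a' b b' \<alpha> R"
| "pair_state a a' b b' \<alpha> R (Suc k) = kept_state (pair_state a a' b b' \<alpha> R k)"

definition round_fidelity ::
  "complex vec \<Rightarrow> complex vec \<Rightarrow> complex vec \<Rightarrow> complex vec \<Rightarrow> real \<Rightarrow> complex \<Rightarrow> nat \<Rightarrow> real" where
  "round_fidelity a a' b b' \<alpha> R k = fidelity (pair_state a a' b b' \<alpha> R k)"

definition round_prob ::
  "complex vec \<Rightarrow> complex vec \<Rightarrow> complex vec \<Rightarrow> complex vec \<Rightarrow> real \<Rightarrow> complex \<Rightarrow> nat \<Rightarrow> real" where
  "round_prob a a' b b' \<alpha> R k = keep_prob (pair_state a a' b b' \<alpha> R (k - 1))"

end

theory Submission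
  imports Defs
begin

text \<open>
  After preparation each pair is in a mixture of \<open>\<Phi>\<^sup>+\<close> and \<open>\<Psi>\<^sup>+\<close> with weights \<open>(1 \<plusminus> r)/2\<close>, where
  \<open>0 < r \<le> 1\<close>, and a round replaces \<open>r\<close> by \<open>2r/(1 + r\<^sup>2)\<close>.

  For optimality, let a distillation operation act on the four products \<open>\<chi>\<close> of the Bell states \<open>\<Phi>\<^sup>+\<close>
  and \<open>\<Psi>\<^sup>+\<close>, and let \<open>p\<^sub>\<chi>\<close>, \<open>q\<^sub>\<chi>\<close> be the probabilities of success with the source pair in \<open>\<Phi>\<^sup>+\<close>,
  resp. orthogonal to it; \<open>p\<^sub>\<chi> + q\<^sub>\<chi> \<le> 1\<close>. The equal mixture of the four products is also
  the equal mixture of the states \<open>|sstt\<rangle>\<close> with \<open>s, t \<in> {+, -}\<close>. These are products between Alice and Bob, and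
  LOCC keeps them so, hence their fidelity with \<open>\<Phi>\<^sup>+\<close> is at most \<open>1/2\<close>; this gives
  \<open>\<Sum> p\<^sub>\<chi> \<le> \<Sum> q\<^sub>\<chi>\<close>. The weights of the four products in the joint state are \<open>(1 + r)\<^sup>2/4\<close>, \<open>(1 - r\<^sup>2)/4\<close> (twice)
  and \<open>(1 - r)\<^sup>2/4\<close>, so the ratio of \<open>\<Sum> \<lambda>\<^sub>\<chi> p\<^sub>\<chi>\<close> to \<open>\<Sum> \<lambda>\<^sub>\<chi> q\<^sub>\<chi>\<close> is at most \<open>(1 + r)\<^sup>2/(1 - r)\<^sup>2\<close>. If \<open>r < 1\<close>, equality
  forces \<open>p\<close> and \<open>q\<close> to be supported on the product of largest and smallest weight, respectively,
  with a common value at most 1, which bounds the success probability by the sum of these two weights.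
\<close>

section \<open>Matrices and positivity\<close>

lemma index_mat_adjoint [simp]:
  "i < dim_col A \<Longrightarrow> j < dim_row A \<Longrightarrow> mat_adjoint A $$ (i, j) = cnj (A $$ (j, i))"
  "dim_row (mat_adjoint A) = dim_col A" "dim_col (mat_adjoint A) = dim_row A"
  by (auto simp: mat_adjoint_def mat_of_rows_def conjugate_complex_def)

lemma mat_adjoint_carrier: "(A :: complex mat) \<in> carrier_mat n m \<Longrightarrow> mat_adjoint A \<in> carrier_mat m n"
  by auto

lemma index_ketbra [simp]:
  "i < dim_vec u \<Longrightarrow> j < dim_vec v \<Longrightarrow> ketbra u v $$ (i, j) = u $ i * cnj (v $ j)"
  "dim_row (ketbra u v) = dim_vec u" "dim_col (ketbra u v) = dim_vec v"
  by (auto simp: ketbra_def)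

lemma ketbra_carrier: "u \<in> carrier_vec n \<Longrightarrow> v \<in> carrier_vec m \<Longrightarrow> ketbra u v \<in> carrier_mat n m"
  by (auto simp: ketbra_def)

lemma cscalar_prod_sum:
  "dim_vec (w :: complex vec) = n \<Longrightarrow> v \<bullet>c w = (\<Sum>i<n. v $ i * cnj (w $ i))"
  by (auto simp: scalar_prod_def conjugate_complex_def lessThan_atLeast0)

lemma index_mat_mult_sum:
  "i < dim_row A \<Longrightarrow> j < dim_col B \<Longrightarrow> dim_col A = dim_row B \<Longrightarrow>
   (A * B) $$ (i, j) = (\<Sum>k<dim_row B. A $$ (i, k) * B $$ (k, j))"
  by (auto simp: scalar_prod_def lessThan_atLeast0)

lemma index_mult_mat_vec_sum:
  "i < dim_row A \<Longrightarrow> dim_col A = dim_vec v \<Longrightarrow>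
   (A *\<^sub>v v) $ i = (\<Sum>k<dim_vec v. A $$ (i, k) * v $ k)"
  by (auto simp: scalar_prod_def lessThan_atLeast0)

lemma quadratic_form_sum:
  assumes "M \<in> carrier_mat n n" "v \<in> carrier_vec n"
  shows "(M *\<^sub>v v) \<bullet>c v = (\<Sum>i<n. \<Sum>j<n. M $$ (i, j) * v $ j * cnj (v $ i))"
  using assms
  by (subst cscalar_prod_sum[of _ n])
    (auto simp: index_mult_mat_vec_sum sum_distrib_right simp del: index_mult_mat_vec intro!: sum.cong)

lemma cscalar_mult_adjoint:
  fixes K :: "complex mat"
  assumes "K \<in> carrier_mat n m" "x \<in> carrier_vec m" "y \<in> carrier_vec n"
  shows "(K *\<^sub>v x) \<bullet>c y = x \<bullet>c (mat_adjoint K *\<^sub>v y)"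
proof -
  have "(K *\<^sub>v x) \<bullet>c y = (\<Sum>i<n. \<Sum>j<m. K $$ (i, j) * x $ j * cnj (y $ i))"
    using assms by (subst cscalar_prod_sum[of _ n])
      (auto simp: index_mult_mat_vec_sum sum_distrib_right simp del: index_mult_mat_vec intro!: sum.cong)
  also have "\<dots> = (\<Sum>j<m. \<Sum>i<n. K $$ (i, j) * x $ j * cnj (y $ i))"
    by (rule sum.swap)
  also have "\<dots> = x \<bullet>c (mat_adjoint K *\<^sub>v y)"
    using assms by (subst cscalar_prod_sum[of _ m])
      (auto simp: index_mult_mat_vec_sum sum_distrib_left cnj_sum simp del: index_mult_mat_vec intro!: sum.cong)
  finally show ?thesis .
qed

section \<open>Closure properties of positive semidefinite matrices\<close>

lemma psd_carrier: "psd n X \<Longrightarrow> X \<in> carrier_mat n n"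
  by (simp add: psd_def)

text \<open>The quadratic form of the conjugated matrix at \<open>v\<close> is that of
  \<open>X\<close> at \<open>mat_adjoint K *\<^sub>v v\<close>.\<close>

lemma psd_conjugate:
  assumes K: "K \<in> carrier_mat n m" and X: "psd m X"
  shows "psd n (K * X * mat_adjoint K)"
  unfolding psd_def
proof (intro conjI ballI)
  have Xc: "X \<in> carrier_mat m m" using X by (rule psd_carrier)
  have Kd: "mat_adjoint K \<in> carrier_mat m n" using K by (rule mat_adjoint_carrier)
  show "K * X * mat_adjoint K \<in> carrier_mat n n" using K Xc Kd by auto
  fix v :: "complex vec" assume v: "v \<in> carrier_vec n"
  let ?w = "mat_adjoint K *\<^sub>v v"
  have w: "?w \<in> carrier_vec m" using Kd v by auto
  have "K * X * mat_adjoint K *\<^sub>v v = K *\<^sub>v (X *\<^sub>v ?w)"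
    using K Xc Kd v by (simp add: assoc_mult_mat_vec[of _ n m _ n] assoc_mult_mat_vec[of _ n m _ m] w)
  then have "(K * X * mat_adjoint K *\<^sub>v v) \<bullet>c v = (X *\<^sub>v ?w) \<bullet>c ?w"
    using cscalar_mult_adjoint[OF K _ v, of "X *\<^sub>v ?w"] Xc w by auto
  then show "0 \<le> (K * X * mat_adjoint K *\<^sub>v v) \<bullet>c v"
    using X w by (simp add: psd_def)
qed

lemma psd_add:
  assumes "psd n X" "psd n Y"
  shows "psd n (X + Y)"
proof -
  have c: "X \<in> carrier_mat n n" "Y \<in> carrier_mat n n" using assms psd_carrier by auto
  have "((X + Y) *\<^sub>v v) \<bullet>c v = (X *\<^sub>v v) \<bullet>c v + (Y *\<^sub>v v) \<bullet>c v" if "v \<in> carrier_vec n" for v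
    using c that by (simp add: quadratic_form_sum[of _ n] sum.distrib ring_distribs)
  then show ?thesis
    using assms c by (simp add: psd_def)
qed

lemma psd_smult:
  assumes "psd n X" "0 \<le> c"
  shows "psd n (complex_of_real c \<cdot>\<^sub>m X)"
proof -
  have c: "X \<in> carrier_mat n n" using assms psd_carrier by auto
  have "((complex_of_real c \<cdot>\<^sub>m X) *\<^sub>v v) \<bullet>c v = complex_of_real c * ((X *\<^sub>v v) \<bullet>c v)"
    if "v \<in> carrier_vec n" for v
    using c that by (simp add: quadratic_form_sum[of _ n] sum_distrib_left mult.assoc)
  then show ?thesis
    using assms c by (auto simp: psd_def less_eq_complex_def)
qed

lemma psd_zero: "psd n (0\<^sub>m n n)"
  by (auto simp: psd_def quadratic_form_sum[of _ n])

text \<open>The quadratic form at \<open>v\<close> is the squared modulus of the inner product of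
  \<open>u\<close> and \<open>v\<close>.\<close>

lemma psd_ketbra:
  assumes u: "u \<in> carrier_vec n"
  shows "psd n (ketbra u u)"
proof -
  have "0 \<le> (ketbra u u *\<^sub>v v) \<bullet>c v" if v: "v \<in> carrier_vec n" for v
  proof -
    let ?s = "\<Sum>i<n. u $ i * cnj (v $ i)"
    have "(ketbra u u *\<^sub>v v) \<bullet>c v = ?s * cnj ?s"
      using u v by (subst quadratic_form_sum[of _ n])
        (auto simp: ketbra_carrier cnj_sum sum_product ac_simps intro!: sum.cong)
    also have "\<dots> = complex_of_real ((cmod ?s)\<^sup>2)"
      by (rule complex_norm_square[symmetric])
    also have "\<dots> \<ge> 0"
      by (simp add: less_eq_complex_def)
    finally show ?thesis .
  qed
  then show ?thesis using u by (simp add: psd_def ketbra_carrier)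
qed

lemma psd_diagonal:
  assumes X: "psd n X" and i: "i < n"
  shows "0 \<le> X $$ (i, i)"
proof -
  have "(X *\<^sub>v unit_vec n i) \<bullet>c unit_vec n i = X $$ (i, i)"
    using i psd_carrier[OF X]
    by (simp add: quadratic_form_sum[of _ n] unit_vec_def if_distrib[of cnj] if_distrib[of "\<lambda>x. _ * x"]
        sum.If_cases cong: if_cong)
  then show ?thesis using X by (metis psd_def unit_vec_carrier)
qed

lemma psd_trace_real:
  assumes "psd n X"
  shows "tr X = complex_of_real (Re (tr X))"
proof -
  have "0 \<le> tr X"
    unfolding tr_def using psd_carrier[OF assms] psd_diagonal[OF assms]
    by (intro sum_nonneg) auto
  then show ?thesis by (simp add: less_eq_complex_def complex_eq_iff)
qed

text \<open>A single Kraus operator keeps pure states pure, so LOCC runs on product states can be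
  followed on vectors.\<close>

lemma conjugate_ketbra:
  assumes "K \<in> carrier_mat m n" "u \<in> carrier_vec n" "v \<in> carrier_vec n"
  shows "K * ketbra u v * mat_adjoint K = ketbra (K *\<^sub>v u) (K *\<^sub>v v)"
proof (rule eq_matI)
  fix i j assume ij: "i < dim_row (ketbra (K *\<^sub>v u) (K *\<^sub>v v))" "j < dim_col (ketbra (K *\<^sub>v u) (K *\<^sub>v v))"
  have *: "(K * ketbra u v) $$ (i, k) = (\<Sum>l<n. K $$ (i, l) * u $ l) * cnj (v $ k)" if "k < n" for k
    using assms ij that
    by (subst index_mat_mult_sum) (auto simp: sum_distrib_right mult.assoc intro!: sum.cong)
  show "(K * ketbra u v * mat_adjoint K) $$ (i, j) = ketbra (K *\<^sub>v u) (K *\<^sub>v v) $$ (i, j)"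
    using assms ij
    by (subst index_mat_mult_sum)
      (auto simp: * index_mult_mat_vec_sum sum_distrib_left ac_simps simp del: index_mult_mat_vec index_mult_mat(1) intro!: sum.cong)
qed (use assms in auto)

section \<open>Relabelling matrices\<close>

text \<open>
  CNOT gates, projections onto basis states and reorderings of qubits all have rows that are zero
  or basis vectors. Conjugation by such a matrix just relabels entries.
\<close>

definition select_mat :: "nat \<Rightarrow> (nat \<Rightarrow> nat) \<Rightarrow> (nat \<Rightarrow> bool) \<Rightarrow> complex mat" where
  "select_mat n f P = mat n n (\<lambda>(i, j). if P i \<and> j = f i then 1 else 0)"

definition relabel :: "nat \<Rightarrow> (nat \<Rightarrow> nat) \<Rightarrow> (nat \<Rightarrow> bool) \<Rightarrow> complex mat \<Rightarrow> complex mat" where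
  "relabel n f P X = mat n n (\<lambda>(i, j). if P i \<and> P j then X $$ (f i, f j) else 0)"

lemma relabel_carrier [simp]: "relabel n f P X \<in> carrier_mat n n"
  by (simp add: relabel_def)

lemma select_mat_carrier [simp]: "select_mat n f P \<in> carrier_mat n n"
  by (simp add: select_mat_def)

lemma index_relabel [simp]:
  "i < n \<Longrightarrow> j < n \<Longrightarrow> relabel n f P X $$ (i, j) = (if P i \<and> P j then X $$ (f i, f j) else 0)"
  "dim_row (relabel n f P X) = n" "dim_col (relabel n f P X) = n"
  by (auto simp: relabel_def)

lemma index_select_mat [simp]:
  "i < n \<Longrightarrow> j < n \<Longrightarrow> select_mat n f P $$ (i, j) = (if P i \<and> j = f i then 1 else 0)"
  "dim_row (select_mat n f P) = n" "dim_col (select_mat n f P) = n"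
  by (auto simp: select_mat_def)

lemma relabel_cong:
  assumes "\<And>i. i < n \<Longrightarrow> P i = Q i" "\<And>i. i < n \<Longrightarrow> P i \<Longrightarrow> f i = g i"
  shows "relabel n f P X = relabel n g Q X"
  by (rule eq_matI) (use assms in auto)

lemma select_mat_cong:
  assumes "\<And>i. i < n \<Longrightarrow> P i = Q i" "\<And>i. i < n \<Longrightarrow> P i \<Longrightarrow> f i = g i"
  shows "select_mat n f P = select_mat n g Q"
  by (rule eq_matI) (use assms in auto)

lemma relabel_relabel:
  assumes "\<And>i. i < n \<Longrightarrow> P i \<Longrightarrow> f i < n"
  shows "relabel n f P (relabel n g Q X) = relabel n (\<lambda>i. g (f i)) (\<lambda>i. P i \<and> Q (f i)) X"
  by (rule eq_matI) (use assms in auto)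

lemma relabel_msum:
  assumes "\<And>i. i < n \<Longrightarrow> P i \<Longrightarrow> f i < n"
  shows "relabel n f P (msum n n Xs) = msum n n (map (relabel n f P) Xs)"
proof (rule eq_matI)
  fix i j assume ij: "i < dim_row (msum n n (map (relabel n f P) Xs))" "j < dim_col (msum n n (map (relabel n f P) Xs))"
  then have "i < n" "j < n" by (auto simp: msum_def)
  then show "relabel n f P (msum n n Xs) $$ (i, j) = msum n n (map (relabel n f P) Xs) $$ (i, j)"
    using assms by (induction Xs) (auto simp: msum_def)
qed (auto simp: msum_def)

text \<open>Multiplication from the left picks row \<open>f i\<close> of \<open>X\<close> as row
  \<open>i\<close>, or zero if \<open>P i\<close> fails; the adjoint on the right does the same to
  the columns.\<close>

lemma conjugate_select_mat:
  assumes f: "\<And>i. i < n \<Longrightarrow> P i \<Longrightarrow> f i < n" and X: "X \<in> carrier_mat n n"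
  shows "select_mat n f P * X * mat_adjoint (select_mat n f P) = relabel n f P X"
proof (rule eq_matI)
  fix i j assume ij: "i < dim_row (relabel n f P X)" "j < dim_col (relabel n f P X)"
  have 1: "(select_mat n f P * X) $$ (i, k) = (if P i then X $$ (f i, k) else 0)" if "k < n" for k
    using X ij that f[of i] by (subst index_mat_mult_sum) (auto simp: if_distrib[of "\<lambda>x. x * _"] cong: if_cong)
  have "(select_mat n f P * X * mat_adjoint (select_mat n f P)) $$ (i, j) =
      (\<Sum>k<n. (select_mat n f P * X) $$ (i, k) * (if P j \<and> k = f j then 1 else 0))"
    using X ij by (subst index_mat_mult_sum) (auto simp del: index_mult_mat(1) intro!: sum.cong)
  also have "\<dots> = (if P j then (select_mat n f P * X) $$ (i, f j) else 0)"
  proof (cases "P j")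
    case True
    then have "f j < n" using ij f by simp
    have "(\<Sum>k<n. g k * (if k = f j then 1 else 0)) = g (f j)" for g :: "nat \<Rightarrow> complex"
      using \<open>f j < n\<close> by (simp add: if_distrib[of "\<lambda>x. _ * x"] cong: if_cong)
    then show ?thesis using True by simp
  qed simp
  also have "\<dots> = relabel n f P X $$ (i, j)"
  proof (cases "P j")
    case True
    then have "f j < n" using ij f by simp
    from 1[OF this] show ?thesis using True ij by (simp del: index_mult_mat(1))
  next
    case False
    then show ?thesis using ij by simp
  qed
  finally show "(select_mat n f P * X * mat_adjoint (select_mat n f P)) $$ (i, j) = relabel n f P X $$ (i, j)" .
qed (use X in auto)

lemma psd_relabel:
  assumes "\<And>i. i < n \<Longrightarrow> P i \<Longrightarrow> f i < n" "psd n X"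
  shows "psd n (relabel n f P X)"
proof -
  have "select_mat n f P * X * mat_adjoint (select_mat n f P) = relabel n f P X"
    using assms(1) psd_carrier[OF assms(2)] by (rule conjugate_select_mat)
  then show ?thesis
    using psd_conjugate[OF select_mat_carrier[of n f P] assms(2)] by simp
qed

lemma select_mat_mult:
  assumes f: "\<And>i. i < n \<Longrightarrow> P i \<Longrightarrow> f i < n"
  shows "select_mat n f P * select_mat n g Q = select_mat n (\<lambda>i. g (f i)) (\<lambda>i. P i \<and> Q (f i))"
proof (rule eq_matI)
  fix i j assume "i < dim_row (select_mat n (\<lambda>i. g (f i)) (\<lambda>i. P i \<and> Q (f i)))"
    "j < dim_col (select_mat n (\<lambda>i. g (f i)) (\<lambda>i. P i \<and> Q (f i)))"
  then show "(select_mat n f P * select_mat n g Q) $$ (i, j) =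
      select_mat n (\<lambda>i. g (f i)) (\<lambda>i. P i \<and> Q (f i)) $$ (i, j)"
    using f[of i] by (subst index_mat_mult_sum) (auto simp: if_distrib[of "\<lambda>x. x * _"] cong: if_cong)
qed auto

section \<open>Tensor products and ampliations of relabellings\<close>

lemma index_tensor_mat [simp]:
  "i < dim_row A * dim_row B \<Longrightarrow> j < dim_col A * dim_col B \<Longrightarrow>
   (A \<otimes>\<^sub>m B) $$ (i, j) = A $$ (i div dim_row B, j div dim_col B) * B $$ (i mod dim_row B, j mod dim_col B)"
  "dim_row (A \<otimes>\<^sub>m B) = dim_row A * dim_row B" "dim_col (A \<otimes>\<^sub>m B) = dim_col A * dim_col B"
  by (auto simp: tensor_mat_def)

lemma div_less_of_less_mult: "(i::nat) < n * m \<Longrightarrow> i div m < n"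
  by (simp add: less_mult_imp_div_less)

lemma mod_less_of_less_mult: "(i::nat) < n * m \<Longrightarrow> i mod m < m"
  by (cases "m = 0") auto

lemma mult_add_less: "(a::nat) < n \<Longrightarrow> b < m \<Longrightarrow> a * m + b < n * m"
proof -
  assume a: "a < n" and b: "b < m"
  have "a * m + b < Suc a * m" using b by simp
  also have "\<dots> \<le> n * m" using a by (intro mult_le_mono1) simp
  finally show ?thesis .
qed

text \<open>An index of the product splits uniquely into quotient and remainder by \<open>m\<close>;
  the bound on \<open>g\<close> makes the new index split into \<open>f\<close> of the quotient and
  \<open>g\<close> of the remainder.\<close>

lemma tensor_select_mat:
  assumes "\<And>i. i < m \<Longrightarrow> Q i \<Longrightarrow> g i < m"
  shows "select_mat n f P \<otimes>\<^sub>m select_mat m g Q =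
    select_mat (n * m) (\<lambda>i. f (i div m) * m + g (i mod m)) (\<lambda>i. P (i div m) \<and> Q (i mod m))"
proof (rule eq_matI)
  fix i j assume "i < dim_row (select_mat (n * m) (\<lambda>i. f (i div m) * m + g (i mod m)) (\<lambda>i. P (i div m) \<and> Q (i mod m)))"
    "j < dim_col (select_mat (n * m) (\<lambda>i. f (i div m) * m + g (i mod m)) (\<lambda>i. P (i div m) \<and> Q (i mod m)))"
  then have ij: "i < n * m" "j < n * m" by auto
  have "j = f (i div m) * m + g (i mod m) \<longleftrightarrow> j div m = f (i div m) \<and> j mod m = g (i mod m)" if "Q (i mod m)"
  proof
    assume "j = f (i div m) * m + g (i mod m)"
    then show "j div m = f (i div m) \<and> j mod m = g (i mod m)"
      using assms[OF _ that] mod_less_of_less_mult[OF ij(1)] by auto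
  next
    assume "j div m = f (i div m) \<and> j mod m = g (i mod m)"
    then show "j = f (i div m) * m + g (i mod m)" by (metis div_mult_mod_eq)
  qed
  then show "(select_mat n f P \<otimes>\<^sub>m select_mat m g Q) $$ (i, j) =
    select_mat (n * m) (\<lambda>i. f (i div m) * m + g (i mod m)) (\<lambda>i. P (i div m) \<and> Q (i mod m)) $$ (i, j)"
    using ij by (auto simp: div_less_of_less_mult mod_less_of_less_mult)
qed auto

text \<open>With this, complete positivity of a relabelling reduces to plain positivity of another
  relabelling, one for each ancilla dimension.\<close>

lemma ampliate_relabel:
  "ampliate n m (relabel n f P) X =
   relabel (n * m) (\<lambda>i. f (i div m) * m + i mod m) (\<lambda>i. P (i div m)) X"
  if "\<And>i. i < n \<Longrightarrow> P i \<Longrightarrow> f i < n"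
  using that by (intro eq_matI) (auto simp: ampliate_def div_less_of_less_mult)

lemma ampliate_msum:
  "ampliate n m (\<lambda>X. msum n n (map (\<lambda>D. D X) Ds)) X = msum (n * m) (n * m) (map (\<lambda>D. ampliate n m D X) Ds)"
proof (rule eq_matI)
  fix i j assume "i < dim_row (msum (n * m) (n * m) (map (\<lambda>D. ampliate n m D X) Ds))"
    "j < dim_col (msum (n * m) (n * m) (map (\<lambda>D. ampliate n m D X) Ds))"
  then have "i < n * m" "j < n * m" by (auto simp: msum_def)
  then show "ampliate n m (\<lambda>X. msum n n (map (\<lambda>D. D X) Ds)) X $$ (i, j) =
     msum (n * m) (n * m) (map (\<lambda>D. ampliate n m D X) Ds) $$ (i, j)"
    by (auto simp: ampliate_def msum_def div_less_of_less_mult o_def intro!: arg_cong[of _ _ sum_list])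
qed (auto simp: ampliate_def msum_def)

lemma psd_msum:
  assumes "\<And>X. X \<in> set Xs \<Longrightarrow> psd n X"
  shows "psd n (msum n n Xs)"
  using assms
proof (induction Xs)
  case Nil
  have "msum n n [] = 0\<^sub>m n n" by (auto simp: msum_def)
  then show ?case by (simp add: psd_zero)
next
  case (Cons X Xs)
  have "msum n n (X # Xs) = X + msum n n Xs"
    using psd_carrier[of n X] Cons.prems by (auto simp: msum_def)
  then show ?case using Cons by (simp add: psd_add)
qed

section \<open>Gates, projections and qubit reorderings as relabellings\<close>

lemma less_4_cases: "(i::nat) < 4 \<longleftrightarrow> i = 0 \<or> i = 1 \<or> i = 2 \<or> i = 3"
  by presburger

lemma less_16_cases:
  "(i::nat) < 16 \<longleftrightarrow> i = 0 \<or> i = 1 \<or> i = 2 \<or> i = 3 \<or> i = 4 \<or> i = 5 \<or> i = 6 \<or> i = 7 \<or>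
     i = 8 \<or> i = 9 \<or> i = 10 \<or> i = 11 \<or> i = 12 \<or> i = 13 \<or> i = 14 \<or> i = 15"
  by presburger

lemma index_tensor_vec [simp]:
  "i < dim_vec u * dim_vec v \<Longrightarrow> (u \<otimes>\<^sub>v v) $ i = u $ (i div dim_vec v) * v $ (i mod dim_vec v)"
  "dim_vec (u \<otimes>\<^sub>v v) = dim_vec u * dim_vec v"
  by (auto simp: tensor_vec_def)

lemma index_ket [simp]:
  "i < 2 \<Longrightarrow> ket x $ i = (if i = x then 1 else 0)" "dim_vec (ket x) = 2"
  by (auto simp: ket_def unit_vec_def)

lemma one_mat_select_mat: "1\<^sub>m n = select_mat n (\<lambda>i. i) (\<lambda>_. True)"
  by (rule eq_matI) auto

lemma projection_select_mat: "ketbra (ket x) (ket x) = select_mat 2 (\<lambda>i. i) (\<lambda>i. i = x)"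
  by (rule eq_matI) auto

text \<open>On two bits this is \<open>(x, y)\<close> to \<open>(x, x + y mod 2)\<close>. It is an
  involution, so it describes the rows and the columns of the gate alike.\<close>

definition cnot_index :: "nat \<Rightarrow> nat" where
  "cnot_index i = 2 * (i div 2) + (i div 2 + i mod 2) mod 2"

lemma cnot_index_less: "i < 4 \<Longrightarrow> cnot_index i < 4"
  by (drule less_4_cases[THEN iffD1], elim disjE; simp add: cnot_index_def)

lemma cnot_select_mat: "cnot = select_mat 4 cnot_index (\<lambda>_. True)"
proof (rule eq_matI)
  fix i j assume "i < dim_row (select_mat 4 cnot_index (\<lambda>_. True))"
    "j < dim_col (select_mat 4 cnot_index (\<lambda>_. True))"
  then have "i = 0 \<or> i = 1 \<or> i = 2 \<or> i = 3" "j = 0 \<or> j = 1 \<or> j = 2 \<or> j = 3"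
    by (simp_all add: less_4_cases)
  then show "cnot $$ (i, j) =
      select_mat 4 cnot_index (\<lambda>_. True) $$ (i, j)"
    by (elim disjE) (simp_all add: cnot_def cnot_index_def)
qed (simp_all add: cnot_def)

lemma swap_select_mat: "swap = select_mat 4 (\<lambda>i. 2 * (i mod 2) + i div 2) (\<lambda>_. True)"
proof (rule eq_matI)
  fix i j assume "i < dim_row (select_mat 4 (\<lambda>i. 2 * (i mod 2) + i div 2) (\<lambda>_. True))"
    "j < dim_col (select_mat 4 (\<lambda>i. 2 * (i mod 2) + i div 2) (\<lambda>_. True))"
  then have "i = 0 \<or> i = 1 \<or> i = 2 \<or> i = 3" "j = 0 \<or> j = 1 \<or> j = 2 \<or> j = 3"
    by (simp_all add: less_4_cases)
  then show "swap $$ (i, j) = select_mat 4 (\<lambda>i. 2 * (i mod 2) + i div 2) (\<lambda>_. True) $$ (i, j)"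
    by (elim disjE) (simp_all add: swap_def msum_def)
qed (simp_all add: swap_def msum_def)

text \<open>Exchanges the binary digits of weight 4 and 2, which belong to qubits 2 and 3.\<close>

definition regroup_index :: "nat \<Rightarrow> nat" where
  "regroup_index i = 8 * (i div 8) + 4 * (i div 2 mod 2) + 2 * (i div 4 mod 2) + i mod 2"

lemma regroup_index_less: "i < 16 \<Longrightarrow> regroup_index i < 16"
  by (drule less_16_cases[THEN iffD1], elim disjE; simp add: regroup_index_def)

lemma regroup_index_involution: "i < 16 \<Longrightarrow> regroup_index (regroup_index i) = i"
  by (drule less_16_cases[THEN iffD1], elim disjE; simp add: regroup_index_def)

lemma regroup_select_mat: "regroup = select_mat 16 regroup_index (\<lambda>_. True)"
proof -
  let ?f = "\<lambda>i::nat. (2 * (i div 2 mod 2) + i div 2 div 2) * 2 + i mod 2"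
  have f: "?f i < 8" if "i < 8" for i
  proof -
    have "i = 0 \<or> i = 1 \<or> i = 2 \<or> i = 3 \<or> i = 4 \<or> i = 5 \<or> i = 6 \<or> i = 7"
      using that by presburger
    then show ?thesis by (elim disjE) simp_all
  qed
  have "swap \<otimes>\<^sub>m 1\<^sub>m 2 = select_mat (4 * 2) ?f (\<lambda>_. True)"
    unfolding one_mat_select_mat swap_select_mat by (subst tensor_select_mat) simp_all
  then have "regroup = select_mat 2 (\<lambda>i. i) (\<lambda>_. True) \<otimes>\<^sub>m select_mat 8 ?f (\<lambda>_. True)"
    by (simp add: regroup_def one_mat_select_mat)
  also have "\<dots> = select_mat (2 * 8) (\<lambda>i. i div 8 * 8 + ?f (i mod 8)) (\<lambda>_. True)"
    by (subst tensor_select_mat) (simp_all only: f simp_thms)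
  also have "\<dots> = select_mat 16 regroup_index (\<lambda>_. True)"
    by (simp, rule select_mat_cong; (drule less_16_cases[THEN iffD1], elim disjE)?; simp add: regroup_index_def)
  finally show ?thesis .
qed

text \<open>The index map is an involution, so \<open>regroup\<close> is its own adjoint and the
  product is a conjugation.\<close>

lemma regroup_conjugate:
  assumes "X \<in> carrier_mat 16 16"
  shows "regroup * X * regroup = relabel 16 regroup_index (\<lambda>_. True) X"
proof -
  have "mat_adjoint regroup = regroup"
    unfolding regroup_select_mat
    by (rule eq_matI) (auto simp: regroup_index_involution)
  moreover have "regroup * X * mat_adjoint regroup = relabel 16 regroup_index (\<lambda>_. True) X"
    unfolding regroup_select_mat
    by (rule conjugate_select_mat[OF _ assms]) (rule regroup_index_less)
  ultimately show ?thesis by simp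
qed

text \<open>Both CNOT gates in the qubit order 1, 2, 3, 4: bit 1 is added to bit 3 and bit 2 to bit
  4, modulo 2.\<close>

definition cnots_index :: "nat \<Rightarrow> nat" where
  "cnots_index i = 8 * (i div 8) + 4 * (i div 4 mod 2) + 2 * ((i div 8 + i div 2) mod 2) + (i div 4 + i) mod 2"

lemma cnots_index_less: "i < 16 \<Longrightarrow> cnots_index i < 16"
  by (drule less_16_cases[THEN iffD1], elim disjE; simp add: cnots_index_def)

lemma nodewise_cnot_select_mat: "nodewise cnot cnot = select_mat 16 cnots_index (\<lambda>_. True)"
proof -
  let ?cc = "\<lambda>i. cnot_index (i div 4) * 4 + cnot_index (i mod 4)"
  have pair_less: "a * 4 + b < 16" if "a < 4" "b < 4" for a b :: nat using that by simp
  have cc: "?cc i < 16" if "i < 16" for i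
    by (intro pair_less cnot_index_less) (use that in auto)
  have "cnot \<otimes>\<^sub>m cnot = select_mat (4 * 4) ?cc (\<lambda>_. True)"
    unfolding cnot_select_mat by (subst tensor_select_mat) (simp_all only: cnot_index_less simp_thms)
  then have 1: "cnot \<otimes>\<^sub>m cnot = select_mat 16 ?cc (\<lambda>_. True)" by simp
  have 2: "regroup * (cnot \<otimes>\<^sub>m cnot) = select_mat 16 (\<lambda>i. ?cc (regroup_index i)) (\<lambda>_. True)"
    unfolding regroup_select_mat 1
    by (subst select_mat_mult) (simp_all only: regroup_index_less simp_thms)
  have "nodewise cnot cnot = select_mat 16 (\<lambda>i. regroup_index (?cc (regroup_index i))) (\<lambda>_. True)"
    unfolding nodewise_def 2 unfolding regroup_select_mat
    by (subst select_mat_mult) (simp_all only: cc regroup_index_less simp_thms)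
  also have "\<dots> = select_mat 16 cnots_index (\<lambda>_. True)"
    by (rule select_mat_cong; (drule less_16_cases[THEN iffD1], elim disjE)?; simp add: regroup_index_def cnot_index_def cnots_index_def)
  finally show ?thesis .
qed

text \<open>The remainder modulo 4 holds the two target bits; \<open>3 * x\<close> is
  \<open>00\<close> for \<open>x = 0\<close> and \<open>11\<close> for \<open>x = 1\<close>.\<close>

lemma outcome_proj_select_mat:
  assumes "x < 2"
  shows "outcome_proj x x = select_mat 16 (\<lambda>i. i) (\<lambda>i. i mod 4 = 3 * x)"
proof -
  have "outcome_proj x x = select_mat 4 (\<lambda>i. i) (\<lambda>_. True) \<otimes>\<^sub>m
     select_mat 4 (\<lambda>i. i div 2 * 2 + i mod 2) (\<lambda>i. i div 2 = x \<and> i mod 2 = x)"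
    unfolding outcome_proj_def one_mat_select_mat projection_select_mat
    by (subst tensor_select_mat) auto
  also have "\<dots> = select_mat (4 * 4) (\<lambda>i. i div 4 * 4 + (i mod 4 div 2 * 2 + i mod 4 mod 2))
      (\<lambda>i. True \<and> i mod 4 div 2 = x \<and> i mod 4 mod 2 = x)"
    by (rule tensor_select_mat) (unfold div_mult_mod_eq)
  also have "\<dots> = select_mat (4 * 4) (\<lambda>i. i) (\<lambda>i. i mod 4 = 3 * x)"
  proof (rule select_mat_cong)
    fix i :: nat
    have "x = 0 \<or> x = 1" using assms by auto
    then show "(True \<and> i mod 4 div 2 = x \<and> i mod 4 mod 2 = x) = (i mod 4 = 3 * x)"
      by presburger
  qed (unfold div_mult_mod_eq, rule refl)
  finally show ?thesis by simp
qed

section \<open>The round as an LOCC operation\<close>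

text \<open>The measurement part of a round as a map on all matrices of size 16, since a
  distillation operation is not confined to inputs
  \<open>\<sigma> \<otimes>\<^sub>m \<sigma>\<close>. The list of maps, one per agreeing result, has
  the shape that \<open>ampliate_msum\<close> expects.\<close>

definition agree_op :: "complex mat \<Rightarrow> complex mat" where
  "agree_op X = msum 16 16 (map (\<lambda>D. D X)
     (map (\<lambda>x. relabel 16 cnots_index (\<lambda>i. i mod 4 = 3 * x)) [0, 1]))"

lemma index_agree_op:
  "i < 16 \<Longrightarrow> j < 16 \<Longrightarrow> agree_op X $$ (i, j) =
    (if i mod 4 = j mod 4 \<and> (i mod 4 = 0 \<or> i mod 4 = 3) then X $$ (cnots_index i, cnots_index j) else 0)"
  by (auto simp: agree_op_def msum_def)

lemma agree_op_carrier: "agree_op X \<in> carrier_mat 16 16"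
  by (simp add: agree_op_def msum_def)

lemma agree_op_dim [simp]: "dim_row (agree_op X) = 16" "dim_col (agree_op X) = 16"
  using agree_op_carrier by auto

lemma agreeing_part_eq_agree_op:
  assumes "\<sigma> \<in> carrier_mat 4 4"
  shows "agreeing_part \<sigma> = agree_op (\<sigma> \<otimes>\<^sub>m \<sigma>)"
proof -
  have c: "\<sigma> \<otimes>\<^sub>m \<sigma> \<in> carrier_mat 16 16" using assms by auto
  have a: "after_cnots \<sigma> = relabel 16 cnots_index (\<lambda>_. True) (\<sigma> \<otimes>\<^sub>m \<sigma>)"
    unfolding after_cnots_def nodewise_cnot_select_mat
    by (rule conjugate_select_mat[OF _ c]) (rule cnots_index_less)
  have "outcome_proj x x * after_cnots \<sigma> * mat_adjoint (outcome_proj x x)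
      = relabel 16 cnots_index (\<lambda>i. i mod 4 = 3 * x) (\<sigma> \<otimes>\<^sub>m \<sigma>)" if "x < 2" for x
  proof -
    have "outcome_proj x x * after_cnots \<sigma> * mat_adjoint (outcome_proj x x)
        = relabel 16 (\<lambda>i. i) (\<lambda>i. i mod 4 = 3 * x) (after_cnots \<sigma>)"
      unfolding outcome_proj_select_mat[OF that] by (rule conjugate_select_mat) (simp_all add: a)
    also have "\<dots> = relabel 16 cnots_index (\<lambda>i. i mod 4 = 3 * x) (\<sigma> \<otimes>\<^sub>m \<sigma>)"
      unfolding a by (subst relabel_relabel) simp_all
    finally show ?thesis .
  qed
  from this[of 0] this[of 1] show ?thesis
    by (simp add: agreeing_part_def agree_op_def)
qed

lemma linear_agree_op: "linear_map_mat 16 agree_op"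
  unfolding linear_map_mat_def
proof (intro conjI ballI allI)
  fix X Y :: "complex mat" and c :: complex
  assume X: "X \<in> carrier_mat 16 16"
  show "agree_op X \<in> carrier_mat 16 16" by (rule agree_op_carrier)
  show "agree_op (c \<cdot>\<^sub>m X) = c \<cdot>\<^sub>m agree_op X"
    using X by (intro eq_matI) (auto simp: index_agree_op cnots_index_less)
  assume Y: "Y \<in> carrier_mat 16 16"
  show "agree_op (X + Y) = agree_op X + agree_op Y"
    using X Y by (intro eq_matI) (auto simp: index_agree_op cnots_index_less)
qed

lemma completely_positive_agree_op: "completely_positive 16 agree_op"
  unfolding completely_positive_def
proof (intro allI impI)
  fix m X assume X: "psd (16 * m) X"
  let ?D = "\<lambda>x. relabel 16 cnots_index (\<lambda>i. i mod 4 = 3 * x)"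
  have "psd (16 * m) (ampliate 16 m (?D x) X)" for x
  proof -
    have "psd (16 * m) (relabel (16 * m) (\<lambda>i. cnots_index (i div m) * m + i mod m) (\<lambda>i. i div m mod 4 = 3 * x) X)"
      by (rule psd_relabel[OF _ X])
        (intro mult_add_less cnots_index_less div_less_of_less_mult mod_less_of_less_mult)
    then show ?thesis
      by (subst ampliate_relabel) (auto simp: cnots_index_less)
  qed
  from this[of 0] this[of 1] show "psd (16 * m) (ampliate 16 m agree_op X)"
    unfolding agree_op_def ampliate_msum by (auto intro!: psd_msum)
qed

text \<open>The diagonal of the image consists of zeros and of diagonal entries of \<open>X\<close>,
  moved by an injective index map; the entries of \<open>X\<close> left out are nonnegative.\<close>

lemma trace_nonincreasing_agree_op: "trace_nonincreasing 16 agree_op"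
  unfolding trace_nonincreasing_def
proof (intro allI impI)
  fix X assume X: "psd 16 X"
  let ?g = "\<lambda>i. Re (X $$ (i, i))"
  have g: "0 \<le> ?g i" if "i < 16" for i
    using psd_diagonal[OF X that] by (simp add: less_eq_complex_def)
  have inj: "inj_on cnots_index {..<16}"
    by (rule inj_on_inverseI[of _ cnots_index])
      (simp, drule less_16_cases[THEN iffD1], elim disjE; simp add: cnots_index_def)
  have "Re (tr (agree_op X)) = (\<Sum>i<16. if i mod 4 = 0 \<or> i mod 4 = 3 then ?g (cnots_index i) else 0)"
    by (auto simp: tr_def index_agree_op intro!: sum.cong)
  also have "\<dots> \<le> (\<Sum>i<16. ?g (cnots_index i))"
    by (intro sum_mono) (auto simp: g cnots_index_less)
  also have "\<dots> = sum ?g (cnots_index ` {..<16})"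
    by (subst sum.reindex[OF inj]) simp
  also have "\<dots> \<le> sum ?g {..<16}"
    by (intro sum_mono2) (auto simp: g cnots_index_less)
  also have "\<dots> = Re (tr X)"
    using psd_carrier[OF X] by (simp add: tr_def)
  finally show "Re (tr (agree_op X)) \<le> Re (tr X)" .
qed

text \<open>A CNOT gate on a party's two qubits, followed by a measurement of the target with result \<open>x\<close>.\<close>

definition target_kraus :: "nat \<Rightarrow> complex mat" where
  "target_kraus x = select_mat 4 cnot_index (\<lambda>i. i mod 2 = x)"

text \<open>Bob measures in the same way in both branches; the announced result of Alice only
  decides which of his results is a success. The measured target qubits stay with the parties, so
  both dimensions are still 4 at the leaves.\<close>

definition agree_protocol :: locc_protocol where
  "agree_protocol = Alice
     [(target_kraus 0, Bob [(target_kraus 0, Stop True), (target_kraus 1, Stop False)]),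
      (target_kraus 1, Bob [(target_kraus 0, Stop False), (target_kraus 1, Stop True)])]"

lemma target_kraus_complete:
  "msum 4 4 [mat_adjoint (target_kraus 0) * target_kraus 0,
     mat_adjoint (target_kraus (Suc 0)) * target_kraus (Suc 0)] = 1\<^sub>m 4"
proof (rule eq_matI)
  fix i j assume "i < dim_row (1\<^sub>m 4 :: complex mat)" "j < dim_col (1\<^sub>m 4 :: complex mat)"
  then have "i = 0 \<or> i = 1 \<or> i = 2 \<or> i = 3" "j = 0 \<or> j = 1 \<or> j = 2 \<or> j = 3"
    by (simp_all add: less_4_cases)
  then show "msum 4 4 [mat_adjoint (target_kraus 0) * target_kraus 0,
     mat_adjoint (target_kraus (Suc 0)) * target_kraus (Suc 0)] $$ (i, j) = 1\<^sub>m 4 $$ (i, j)"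
    by (elim disjE) (simp_all add: msum_def target_kraus_def index_mat_mult_sum cnot_index_def
        lessThan_nat_numeral lessThan_Suc del: index_mult_mat(1))
qed (simp_all add: msum_def)

lemma target_kraus_dim [simp]: "dim_row (target_kraus x) = 4" "dim_col (target_kraus x) = 4"
  by (simp_all add: target_kraus_def)

lemma agree_protocol_wf: "locc_wf agree_protocol 4 4"
  using target_kraus_complete by (simp add: agree_protocol_def)

lemma target_kraus_Alice:
  assumes "X \<in> carrier_mat 16 16"
  shows "(target_kraus x \<otimes>\<^sub>m 1\<^sub>m 4) * X * mat_adjoint (target_kraus x \<otimes>\<^sub>m 1\<^sub>m 4) =
    relabel 16 (\<lambda>i. cnot_index (i div 4) * 4 + i mod 4) (\<lambda>i. i div 4 mod 2 = x) X"
proof -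
  have "target_kraus x \<otimes>\<^sub>m 1\<^sub>m 4 = select_mat (4 * 4)
      (\<lambda>i. cnot_index (i div 4) * 4 + i mod 4) (\<lambda>i. i div 4 mod 2 = x \<and> True)"
    unfolding one_mat_select_mat target_kraus_def by (rule tensor_select_mat)
  then have s: "target_kraus x \<otimes>\<^sub>m 1\<^sub>m 4 = select_mat 16
      (\<lambda>i. cnot_index (i div 4) * 4 + i mod 4) (\<lambda>i. i div 4 mod 2 = x)" by simp
  show ?thesis
    unfolding s
  proof (rule conjugate_select_mat[OF _ assms])
    fix i :: nat assume "i < 16"
    then have "cnot_index (i div 4) * 4 + i mod 4 < 4 * 4"
      by (intro mult_add_less cnot_index_less) auto
    then show "cnot_index (i div 4) * 4 + i mod 4 < 16" by simp
  qed
qed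

lemma target_kraus_Bob:
  assumes "X \<in> carrier_mat 16 16"
  shows "(1\<^sub>m 4 \<otimes>\<^sub>m target_kraus x) * X * mat_adjoint (1\<^sub>m 4 \<otimes>\<^sub>m target_kraus x) =
    relabel 16 (\<lambda>i. i div 4 * 4 + cnot_index (i mod 4)) (\<lambda>i. i mod 4 mod 2 = x) X"
proof -
  have "1\<^sub>m 4 \<otimes>\<^sub>m target_kraus x = select_mat (4 * 4)
      (\<lambda>i. i div 4 * 4 + cnot_index (i mod 4)) (\<lambda>i. True \<and> i mod 4 mod 2 = x)"
    unfolding one_mat_select_mat target_kraus_def by (rule tensor_select_mat) (rule cnot_index_less)
  then have s: "1\<^sub>m 4 \<otimes>\<^sub>m target_kraus x = select_mat 16
      (\<lambda>i. i div 4 * 4 + cnot_index (i mod 4)) (\<lambda>i. i mod 4 mod 2 = x)" by simp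
  show ?thesis
    unfolding s
  proof (rule conjugate_select_mat[OF _ assms])
    fix i :: nat assume "i < 16"
    then have "i div 4 * 4 + cnot_index (i mod 4) < 4 * 4"
      by (intro mult_add_less cnot_index_less) auto
    then show "i div 4 * 4 + cnot_index (i mod 4) < 16" by simp
  qed
qed

text \<open>Regrouping, the two local steps and regrouping back compose to a single index map, which
  is compared with \<open>cnots_index\<close> on all 16 indices. The conditions of Alice and Bob
  together say that both target bits equal \<open>x\<close>.\<close>

lemma target_kraus_both:
  assumes X: "X \<in> carrier_mat 16 16" and x: "x < 2"
  shows "relabel 16 regroup_index (\<lambda>_. True)
     (relabel 16 (\<lambda>i. i div 4 * 4 + cnot_index (i mod 4)) (\<lambda>i. i mod 4 mod 2 = x)
     (relabel 16 (\<lambda>i. cnot_index (i div 4) * 4 + i mod 4) (\<lambda>i. i div 4 mod 2 = x)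
     (relabel 16 regroup_index (\<lambda>_. True) X))) =
    relabel 16 cnots_index (\<lambda>i. i mod 4 = 3 * x) X"
proof -
  have x: "x = 0 \<or> x = 1" using x by auto
  have b: "cnot_index (i div 4) * 4 + i mod 4 < 16" "i div 4 * 4 + cnot_index (i mod 4) < 16" if "i < 16" for i
  proof -
    have "cnot_index (i div 4) * 4 + i mod 4 < 4 * 4" "i div 4 * 4 + cnot_index (i mod 4) < 4 * 4"
      using that by (intro mult_add_less cnot_index_less; auto)+
    then show "cnot_index (i div 4) * 4 + i mod 4 < 16" "i div 4 * 4 + cnot_index (i mod 4) < 16" by simp_all
  qed
  let ?a = "\<lambda>i. cnot_index (i div 4) * 4 + i mod 4"
  let ?b = "\<lambda>i. i div 4 * 4 + cnot_index (i mod 4)"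
  have f: "regroup_index (?a (?b (regroup_index i))) = cnots_index i" if "i < 16" for i
    using that by (drule_tac less_16_cases[THEN iffD1], elim disjE)
      (simp_all add: regroup_index_def cnot_index_def cnots_index_def)
  have P: "regroup_index i mod 4 mod 2 = i mod 2" "?b (regroup_index i) div 4 mod 2 = i div 2 mod 2" if "i < 16" for i
    using that by (drule_tac less_16_cases[THEN iffD1], elim disjE;
      simp add: regroup_index_def cnot_index_def)+
  have "relabel 16 regroup_index (\<lambda>_. True)
     (relabel 16 ?b (\<lambda>i. i mod 4 mod 2 = x)
     (relabel 16 ?a (\<lambda>i. i div 4 mod 2 = x)
     (relabel 16 regroup_index (\<lambda>_. True) X))) =
    relabel 16 (\<lambda>i. regroup_index (?a (?b (regroup_index i))))
      (\<lambda>i. regroup_index i mod 4 mod 2 = x \<and> ?b (regroup_index i) div 4 mod 2 = x) X"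
    by (simp only: relabel_relabel b regroup_index_less simp_thms)
  also have "\<dots> = relabel 16 cnots_index (\<lambda>i. i mod 4 = 3 * x) X"
  proof (rule relabel_cong)
    fix i :: nat assume i: "i < 16"
    show "(regroup_index i mod 4 mod 2 = x \<and> ?b (regroup_index i) div 4 mod 2 = x) = (i mod 4 = 3 * x)"
      unfolding P[OF i] using x by presburger
  qed (rule f)
  finally show ?thesis .
qed

lemma msum_pair_zero:
  "X \<in> carrier_mat n n \<Longrightarrow> msum n n [X, 0\<^sub>m n n] = X"
  "X \<in> carrier_mat n n \<Longrightarrow> msum n n [0\<^sub>m n n, X] = X"
  by (rule eq_matI; auto simp: msum_def)+

lemma locc_implementable_agree_op: "locc_implementable agree_op"
  unfolding locc_implementable_def
proof (intro exI conjI ballI)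
  show "locc_wf agree_protocol 4 4" by (rule agree_protocol_wf)
  fix X :: "complex mat" assume X: "X \<in> carrier_mat 16 16"
  let ?Y = "relabel 16 regroup_index (\<lambda>_. True) X"
  let ?Z = "\<lambda>x. relabel 16 (\<lambda>i. i div 4 * 4 + cnot_index (i mod 4)) (\<lambda>i. i mod 4 mod 2 = x)
     (relabel 16 (\<lambda>i. cnot_index (i div 4) * 4 + i mod 4) (\<lambda>i. i div 4 mod 2 = x) ?Y)"
  \<comment> \<open>The two branches with different results contribute zero matrices.\<close>
  have run: "locc_run agree_protocol 4 4 ?Y = msum 16 16 [?Z 0, ?Z 1]"
    by (simp add: agree_protocol_def target_kraus_Alice target_kraus_Bob msum_pair_zero)
  have "regroup * locc_run agree_protocol 4 4 (regroup * X * regroup) * regroup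
      = relabel 16 regroup_index (\<lambda>_. True) (msum 16 16 [?Z 0, ?Z 1])"
    unfolding regroup_conjugate[OF X] run
    by (rule regroup_conjugate) (simp add: msum_def)
  also have "\<dots> = agree_op X"
    using target_kraus_both[OF X, of 0] target_kraus_both[OF X, of 1]
    by (simp add: relabel_msum regroup_index_less agree_op_def)
  finally show "agree_op X = regroup * locc_run agree_protocol 4 4 (regroup * X * regroup) * regroup" ..
qed

lemma distillation_op_agree_op: "distillation_op agree_op"
  by (simp add: distillation_op_def quantum_operation_def linear_agree_op completely_positive_agree_op
      trace_nonincreasing_agree_op locc_implementable_agree_op)

section \<open>Tensor products and partial traces\<close>

lemma sum_div_mod:
  fixes f :: "nat \<Rightarrow> nat \<Rightarrow> 'a::comm_monoid_add"
  shows "(\<Sum>k<n * m. f (k div m) (k mod m)) = (\<Sum>a<n. \<Sum>b<m. f a b)"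
proof -
  have "(\<Sum>k<n * m. f (k div m) (k mod m)) = (\<Sum>a<n. sum (\<lambda>k. f (k div m) (k mod m)) {a * m..<a * m + m})"
    by (rule sum.nat_group[symmetric])
  also have "\<dots> = (\<Sum>a<n. \<Sum>b<m. f a b)"
  proof (rule sum.cong)
    fix a
    have "sum (\<lambda>k. f (k div m) (k mod m)) {a * m..<a * m + m} = (\<Sum>b<m. f ((b + a * m) div m) ((b + a * m) mod m))"
      using sum.shift_bounds_nat_ivl[of "\<lambda>k. f (k div m) (k mod m)" 0 "a * m" m]
      by (simp add: lessThan_atLeast0 add.commute)
    then show "sum (\<lambda>k. f (k div m) (k mod m)) {a * m..<a * m + m} = (\<Sum>b<m. f a b)"
      by simp
  qed simp
  finally show ?thesis .
qed

lemma tensor_mat_mult_tensor_vec: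
  assumes "dim_col A = dim_vec u" "dim_col B = dim_vec v"
  shows "(A \<otimes>\<^sub>m B) *\<^sub>v (u \<otimes>\<^sub>v v) = (A *\<^sub>v u) \<otimes>\<^sub>v (B *\<^sub>v v)"
proof (rule eq_vecI)
  fix i assume "i < dim_vec ((A *\<^sub>v u) \<otimes>\<^sub>v (B *\<^sub>v v))"
  then have i: "i < dim_row A * dim_row B" by simp
  let ?n = "dim_vec u" and ?m = "dim_vec v"
  let ?a = "\<lambda>k. A $$ (i div dim_row B, k) * u $ k" and ?b = "\<lambda>k. B $$ (i mod dim_row B, k) * v $ k"
  have "((A \<otimes>\<^sub>m B) *\<^sub>v (u \<otimes>\<^sub>v v)) $ i = (\<Sum>k<?n * ?m. ?a (k div ?m) * ?b (k mod ?m))"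
    using i assms by (subst index_mult_mat_vec_sum) (auto simp: ac_simps simp del: index_mult_mat_vec intro!: sum.cong)
  also have "\<dots> = (\<Sum>k<?n. ?a k) * (\<Sum>k<?m. ?b k)"
    by (subst sum_div_mod) (simp add: sum_product)
  also have "\<dots> = ((A *\<^sub>v u) \<otimes>\<^sub>v (B *\<^sub>v v)) $ i"
    using i assms by (simp add: index_mult_mat_vec_sum div_less_of_less_mult mod_less_of_less_mult del: index_mult_mat_vec)
  finally show "((A \<otimes>\<^sub>m B) *\<^sub>v (u \<otimes>\<^sub>v v)) $ i = ((A *\<^sub>v u) \<otimes>\<^sub>v (B *\<^sub>v v)) $ i" .
qed simp

lemma tensor_ketbra: "ketbra u u \<otimes>\<^sub>m ketbra v v = ketbra (u \<otimes>\<^sub>v v) (u \<otimes>\<^sub>v v)"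
  by (rule eq_matI) (auto simp: div_less_of_less_mult mod_less_of_less_mult)

section \<open>The partial trace over the target pair\<close>

lemma ptrace34_dim [simp]: "dim_row (ptrace34 X) = 4" "dim_col (ptrace34 X) = 4"
  by (simp_all add: ptrace34_def)

lemma ptrace34_carrier [simp]: "ptrace34 X \<in> carrier_mat 4 4"
  by (simp add: ptrace34_def)

lemma sum_lessThan_4:
  fixes f :: "nat \<Rightarrow> 'a::comm_monoid_add"
  shows "(\<Sum>i<4. f i) = f 0 + f 1 + f 2 + f 3"
  by (simp add: lessThan_nat_numeral lessThan_Suc ac_simps)

lemma tr_ptrace34:
  assumes "X \<in> carrier_mat 16 16"
  shows "tr (ptrace34 X) = tr X"
proof -
  have "(\<Sum>k<4 * 4. X $$ (k div 4 * 4 + k mod 4, k div 4 * 4 + k mod 4)) =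
      (\<Sum>a<4. \<Sum>b<4. X $$ (a * 4 + b, a * 4 + b))"
    by (rule sum_div_mod)
  then show ?thesis
    using assms by (simp add: tr_def ptrace34_def)
qed

text \<open>The quadratic form of the partial trace at \<open>v\<close> is the sum over
  \<open>k\<close> of the forms of \<open>X\<close> at
  \<open>v \<otimes>\<^sub>v unit_vec 4 k\<close>.\<close>

lemma psd_ptrace34:
  assumes X: "psd 16 X"
  shows "psd 4 (ptrace34 X)"
proof -
  have "0 \<le> (ptrace34 X *\<^sub>v v) \<bullet>c v" if v: "v \<in> carrier_vec 4" for v
  proof -
    let ?w = "\<lambda>k. v \<otimes>\<^sub>v unit_vec 4 k"
    have wc: "?w k \<in> carrier_vec 16" for k using v by (auto intro!: carrier_vecI)
    have "(X *\<^sub>v ?w k) \<bullet>c ?w k = (\<Sum>i<4. \<Sum>j<4. X $$ (i * 4 + k, j * 4 + k) * v $ j * cnj (v $ i))" if k: "k < 4" for k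
    proof -
      \<comment> \<open>The vector \<open>?w k\<close> vanishes outside the indices
        \<open>a * 4 + k\<close>, so sums against it collapse from 16 to 4 terms.\<close>
      have s: "(\<Sum>j<16. g j * (?w k $ j)) = (\<Sum>a<4. g (a * 4 + k) * v $ a)" for g :: "nat \<Rightarrow> complex"
      proof -
        have "(\<Sum>j<4 * 4. g (j div 4 * 4 + j mod 4) * (v $ (j div 4) * (if j mod 4 = k then 1 else 0))) =
            (\<Sum>a<4. \<Sum>b<4. g (a * 4 + b) * (v $ a * (if b = k then 1 else 0)))"
          by (rule sum_div_mod)
        also have "\<dots> = (\<Sum>a<4. g (a * 4 + k) * v $ a)"
          using k by (simp add: if_distrib[of "\<lambda>x. _ * x"] cong: if_cong)
        finally show ?thesis using v k by (simp add: unit_vec_def)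
      qed
      have "(X *\<^sub>v ?w k) \<bullet>c ?w k = (\<Sum>i<16. (\<Sum>j<16. X $$ (i, j) * ?w k $ j) * cnj (?w k $ i))"
        by (subst quadratic_form_sum[OF psd_carrier[OF X] wc]) (simp add: sum_distrib_right)
      also have "\<dots> = (\<Sum>i<16. (\<Sum>a<4. X $$ (i, a * 4 + k) * v $ a) * cnj (?w k $ i))"
        unfolding s ..
      \<comment> \<open>The conjugation moves to the other factor, so that \<open>s\<close> also
        applies to the sum against the conjugated vector.\<close>
      also have "\<dots> = cnj (\<Sum>i<16. cnj (\<Sum>a<4. X $$ (i, a * 4 + k) * v $ a) * ?w k $ i)"
        by (simp del: index_tensor_vec)
      also have "\<dots> = cnj (\<Sum>i<4. cnj (\<Sum>a<4. X $$ (i * 4 + k, a * 4 + k) * v $ a) * v $ i)"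
        by (subst s) (rule refl)
      also have "\<dots> = (\<Sum>i<4. \<Sum>j<4. X $$ (i * 4 + k, j * 4 + k) * v $ j * cnj (v $ i))"
        by (simp add: sum_distrib_right)
      finally show ?thesis .
    qed
    then have "(\<Sum>k<4. (X *\<^sub>v ?w k) \<bullet>c ?w k) =
        (\<Sum>k<4. \<Sum>i<4. \<Sum>j<4. X $$ (i * 4 + k, j * 4 + k) * v $ j * cnj (v $ i))"
      by simp
    also have "\<dots> = (\<Sum>i<4. \<Sum>k<4. \<Sum>j<4. X $$ (i * 4 + k, j * 4 + k) * v $ j * cnj (v $ i))"
      by (rule sum.swap)
    also have "\<dots> = (\<Sum>i<4. \<Sum>j<4. \<Sum>k<4. X $$ (i * 4 + k, j * 4 + k) * v $ j * cnj (v $ i))"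
      by (intro sum.cong refl sum.swap)
    also have "\<dots> = (ptrace34 X *\<^sub>v v) \<bullet>c v"
      by (subst quadratic_form_sum[OF ptrace34_carrier v])
        (simp add: ptrace34_def sum_distrib_right)
    finally have "(ptrace34 X *\<^sub>v v) \<bullet>c v = (\<Sum>k<4. (X *\<^sub>v ?w k) \<bullet>c ?w k)" ..
    moreover have "0 \<le> (X *\<^sub>v ?w k) \<bullet>c ?w k" for k
      using X wc[of k] by (simp add: psd_def)
    ultimately show ?thesis by (simp add: sum_nonneg)
  qed
  then show ?thesis by (simp add: psd_def)
qed

section \<open>Fidelity in terms of matrix entries\<close>

lemma index_Phi_plus:
  "i < 4 \<Longrightarrow> Phi_plus $ i = (if i = 0 \<or> i = 3 then complex_of_real (1 / sqrt 2) else 0)"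
  by (drule less_4_cases[THEN iffD1], elim disjE; simp add: Phi_plus_def)

lemma dim_Phi_plus [simp]: "dim_vec Phi_plus = 4"
  by (simp add: Phi_plus_def)

lemma Phi_plus_carrier: "Phi_plus \<in> carrier_vec 4"
  by (simp add: carrier_vecI)

lemma fidelity_entries:
  assumes "M \<in> carrier_mat 4 4"
  shows "fidelity M = (Re (M $$ (0, 0)) + Re (M $$ (0, 3)) + Re (M $$ (3, 0)) + Re (M $$ (3, 3))) / 2"
proof -
  have c: "complex_of_real (sqrt 2) * complex_of_real (sqrt 2) = 2"
    by (simp flip: of_real_mult)
  have "(M *\<^sub>v Phi_plus) \<bullet>c Phi_plus = (M $$ (0, 0) + M $$ (0, 3) + M $$ (3, 0) + M $$ (3, 3)) / 2"
    unfolding quadratic_form_sum[OF assms Phi_plus_carrier] sum_lessThan_4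
    by (simp add: index_Phi_plus c add_divide_distrib)
  then have "fidelity M = Re ((M $$ (0, 0) + M $$ (0, 3) + M $$ (3, 0) + M $$ (3, 3)) / 2)"
    by (simp only: fidelity_def)
  then show ?thesis by simp
qed

lemma fidelity_nonneg: "psd 4 M \<Longrightarrow> 0 \<le> fidelity M"
  using Phi_plus_carrier by (simp add: psd_def fidelity_def less_eq_complex_def)

lemma fidelity_le_trace:
  assumes M: "psd 4 M"
  shows "fidelity M \<le> Re (tr M)"
proof -
  have Mc: "M \<in> carrier_mat 4 4" using M by (rule psd_carrier)
  \<comment> \<open>The unnormalized Bell state \<open>|00> - |11>\<close>. Positivity there bounds
    the off-diagonal entries in the fidelity by the diagonal ones.\<close>
  define v where "v = vec 4 (\<lambda>i. if i = 0 then 1 else if i = 3 then -1 else (0::complex))"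
  have v: "v \<in> carrier_vec 4" by (simp add: v_def)
  have vi: "v $ 0 = 1" "v $ 1 = 0" "v $ Suc 0 = 0" "v $ 2 = 0" "v $ 3 = -1" by (simp_all add: v_def)
  have "0 \<le> (M *\<^sub>v v) \<bullet>c v" using M v by (simp add: psd_def)
  then have 1: "0 \<le> Re (M $$ (0, 0)) - Re (M $$ (0, 3)) - Re (M $$ (3, 0)) + Re (M $$ (3, 3))"
    unfolding quadratic_form_sum[OF Mc v] sum_lessThan_4 by (simp add: vi less_eq_complex_def)
  have "0 \<le> Re (M $$ (1, 1))" "0 \<le> Re (M $$ (2, 2))"
    using psd_diagonal[OF M, of 1] psd_diagonal[OF M, of 2] by (simp_all add: less_eq_complex_def)
  moreover have "Re (tr M) = Re (M $$ (0, 0)) + Re (M $$ (1, 1)) + Re (M $$ (2, 2)) + Re (M $$ (3, 3))"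
    using Mc by (simp add: tr_def sum_lessThan_4)
  ultimately show ?thesis
    using 1 by (simp add: fidelity_entries[OF Mc])
qed

section \<open>Product states under LOCC\<close>

text \<open>\<open>Y\<close> is in the node-wise qubit order, hence the relabelling.\<close>

definition gap :: "complex mat \<Rightarrow> real" where
  "gap Y = Re (tr Y) - 2 * fidelity (ptrace34 (relabel 16 regroup_index (\<lambda>_. True) Y))"

lemma fidelity_ptrace34_entries:
  "fidelity (ptrace34 X) = (\<Sum>k<4. Re (X $$ (k, k)) + Re (X $$ (k, 12 + k)) + Re (X $$ (12 + k, k)) + Re (X $$ (12 + k, 12 + k))) / 2"
  by (simp add: fidelity_entries ptrace34_def sum.distrib)

text \<open>Additivity lets the runs of a protocol be bounded one by one.\<close>

lemma gap_msum:
  assumes "\<And>Y. Y \<in> set Ys \<Longrightarrow> Y \<in> carrier_mat 16 16"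
  shows "gap (msum 16 16 Ys) = sum_list (map gap Ys)"
  using assms
proof (induction Ys)
  case Nil
  then show ?case
    by (simp add: gap_def fidelity_ptrace34_entries msum_def tr_def regroup_index_less)
next
  case (Cons Y Ys)
  have "gap (msum 16 16 (Y # Ys)) = gap Y + gap (msum 16 16 Ys)"
    using Cons.prems[of Y]
    by (simp add: gap_def fidelity_ptrace34_entries msum_def tr_def regroup_index_less sum.distrib algebra_simps
        add_divide_distrib)
  then show ?case using Cons by simp
qed

text \<open>Cauchy-Schwarz in dimension 2. After the triangle inequality, the difference of the two
  sides is the square of \<open>cmod a * cmod d - cmod c * cmod b\<close>.\<close>

lemma norm_mult_add_le:
  fixes a b c d :: complex
  shows "(cmod (a * b + c * d))\<^sup>2 \<le> ((cmod a)\<^sup>2 + (cmod c)\<^sup>2) * ((cmod b)\<^sup>2 + (cmod d)\<^sup>2)"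
proof -
  have "(cmod (a * b + c * d))\<^sup>2 \<le> (cmod a * cmod b + cmod c * cmod d)\<^sup>2"
    using norm_triangle_ineq[of "a * b" "c * d"] by (intro power_mono) (simp_all add: norm_mult)
  also have "\<dots> \<le> ((cmod a)\<^sup>2 + (cmod c)\<^sup>2) * ((cmod b)\<^sup>2 + (cmod d)\<^sup>2)"
    using zero_le_power2[of "cmod a * cmod d - cmod c * cmod b"]
    by (simp add: power2_eq_square algebra_simps)
  finally show ?thesis .
qed

text \<open>A product state has fidelity at most one half with a maximally entangled two-qubit state.\<close>

lemma gap_product_nonneg:
  assumes u: "u \<in> carrier_vec 4" and v: "v \<in> carrier_vec 4"
  shows "0 \<le> gap (ketbra (u \<otimes>\<^sub>v v) (u \<otimes>\<^sub>v v))"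
proof -
  let ?w = "u \<otimes>\<^sub>v v"
  let ?n = "\<lambda>x y. (cmod x)\<^sup>2 + (cmod y)\<^sup>2"
  have d: "dim_vec u = 4" "dim_vec v = 4" using u v by auto
  have sq: "Re (x * cnj x) + Re (x * cnj y) + Re (y * cnj x) + Re (y * cnj y) = (cmod (x + y))\<^sup>2" for x y :: complex
    unfolding cmod_power2 by (simp add: power2_eq_square algebra_simps)
  have pi: "regroup_index 0 = 0" "regroup_index (Suc 0) = 1" "regroup_index 2 = 4" "regroup_index 3 = 5"
     "regroup_index 12 = 10" "regroup_index 13 = 11" "regroup_index 14 = 14" "regroup_index 15 = 15"
    by (simp_all add: regroup_index_def)
  \<comment> \<open>The index \<open>k\<close> runs over the basis of the target pair;
    \<open>k\<close> and \<open>12 + k\<close> carry the source states \<open>|00>\<close> and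
    \<open>|11>\<close>, whose amplitudes are added.\<close>
  have "2 * fidelity (ptrace34 (relabel 16 regroup_index (\<lambda>_. True) (ketbra ?w ?w))) =
      (\<Sum>k<4. (cmod (?w $ regroup_index k + ?w $ regroup_index (12 + k)))\<^sup>2)"
    by (simp add: fidelity_ptrace34_entries d regroup_index_less sq del: index_tensor_vec(1) times_complex.sel)
  also have "\<dots> = (cmod (u $ 0 * v $ 0 + u $ 2 * v $ 2))\<^sup>2 + (cmod (u $ 0 * v $ 1 + u $ 2 * v $ 3))\<^sup>2
      + (cmod (u $ 1 * v $ 0 + u $ 3 * v $ 2))\<^sup>2 + (cmod (u $ 1 * v $ 1 + u $ 3 * v $ 3))\<^sup>2"
    by (simp add: sum_lessThan_4 pi d)
  \<comment> \<open>The high bits of the indices of \<open>u\<close> and \<open>v\<close> are the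
    source qubits, the low bits the target qubits. Each summand has fixed low bits and adds over
    equal high bits, so Cauchy-Schwarz separates \<open>u\<close> from \<open>v\<close>.\<close>
  also have "\<dots> \<le> ?n (u $ 0) (u $ 2) * ?n (v $ 0) (v $ 2) + ?n (u $ 0) (u $ 2) * ?n (v $ 1) (v $ 3)
      + ?n (u $ 1) (u $ 3) * ?n (v $ 0) (v $ 2) + ?n (u $ 1) (u $ 3) * ?n (v $ 1) (v $ 3)"
    by (intro add_mono norm_mult_add_le)
  also have "\<dots> = (\<Sum>a<4. \<Sum>b<4. (cmod (u $ a * v $ b))\<^sup>2)"
    by (simp add: sum_lessThan_4 norm_mult power_mult_distrib algebra_simps)
  also have "\<dots> = (\<Sum>k<4 * 4. (cmod (u $ (k div 4) * v $ (k mod 4)))\<^sup>2)"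
    by (rule sum_div_mod[symmetric])
  also have "\<dots> = Re (tr (ketbra ?w ?w))"
    by (simp add: tr_def d complex_norm_square[symmetric] del: complex_cnj_mult flip: of_real_power)
  finally show ?thesis by (simp add: gap_def)
qed

text \<open>Induction over the protocol: a local Kraus operator sends a product vector to an
  unnormalized product vector, possibly of other dimensions, a successful leaf is covered by
  \<open>gap_product_nonneg\<close>, and \<open>gap\<close> adds up over the branches. The carrier
  claim is carried along for this additivity.\<close>

lemma locc_run_product:
  assumes "locc_wf p dA dB" "u \<in> carrier_vec dA" "v \<in> carrier_vec dB"
  shows "locc_run p dA dB (ketbra (u \<otimes>\<^sub>v v) (u \<otimes>\<^sub>v v)) \<in> carrier_mat 16 16 \<and>
    0 \<le> gap (locc_run p dA dB (ketbra (u \<otimes>\<^sub>v v) (u \<otimes>\<^sub>v v)))"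
  using assms
proof (induction p dA dB arbitrary: u v rule: locc_wf.induct)
  case (1 success dA dB)
  have "msum 16 16 [] = 0\<^sub>m 16 16" by (auto simp: msum_def)
  then have "gap (0\<^sub>m 16 16) = 0"
    using gap_msum[of "[]"] by simp
  then show ?case
    using 1 gap_product_nonneg[of u v] by (auto intro!: carrier_matI)
next
  case (2 br dA dB)
  let ?w = "u \<otimes>\<^sub>v v"
  let ?r = "\<lambda>(K, p). locc_run p (dim_row K) dB ((K \<otimes>\<^sub>m 1\<^sub>m dB) * ketbra ?w ?w * mat_adjoint (K \<otimes>\<^sub>m 1\<^sub>m dB))"
  have *: "?r Kp \<in> carrier_mat 16 16 \<and> 0 \<le> gap (?r Kp)" if Kp: "Kp \<in> set br" for Kp
  proof -
    obtain K p where Kpe: "Kp = (K, p)" by (cases Kp)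
    have K: "dim_col K = dA" "locc_wf p (dim_row K) dB" using 2 Kp Kpe by auto
    have "(K \<otimes>\<^sub>m 1\<^sub>m dB) * ketbra ?w ?w * mat_adjoint (K \<otimes>\<^sub>m 1\<^sub>m dB)
        = ketbra ((K \<otimes>\<^sub>m 1\<^sub>m dB) *\<^sub>v ?w) ((K \<otimes>\<^sub>m 1\<^sub>m dB) *\<^sub>v ?w)"
      by (rule conjugate_ketbra[of _ "dim_row K * dB" "dA * dB"])
        (use K 2 in \<open>auto intro!: carrier_matI carrier_vecI\<close>)
    also have "(K \<otimes>\<^sub>m 1\<^sub>m dB) *\<^sub>v ?w = (K *\<^sub>v u) \<otimes>\<^sub>v v"
      using K 2(3,4) by (subst tensor_mat_mult_tensor_vec) auto
    finally have eq: "(K \<otimes>\<^sub>m 1\<^sub>m dB) * ketbra ?w ?w * mat_adjoint (K \<otimes>\<^sub>m 1\<^sub>m dB)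
        = ketbra ((K *\<^sub>v u) \<otimes>\<^sub>v v) ((K *\<^sub>v u) \<otimes>\<^sub>v v)" .
    have "K *\<^sub>v u \<in> carrier_vec (dim_row K)" by (rule carrier_vecI) simp
    from 2(1)[OF Kp Kpe[symmetric] K(2) this 2(4)] show ?thesis
      unfolding Kpe prod.case eq .
  qed
  have run: "locc_run (Alice br) dA dB (ketbra ?w ?w) = msum 16 16 (map ?r br)"
    by simp
  have "gap (msum 16 16 (map ?r br)) = sum_list (map gap (map ?r br))"
    by (rule gap_msum) (use * in auto)
  moreover have "0 \<le> sum_list (map gap (map ?r br))"
    by (intro sum_list_nonneg) (use * in auto)
  ultimately show ?case
    unfolding run by (simp add: msum_def)
next
  case (3 br dA dB)
  let ?w = "u \<otimes>\<^sub>v v"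
  let ?r = "\<lambda>(K, p). locc_run p dA (dim_row K) ((1\<^sub>m dA \<otimes>\<^sub>m K) * ketbra ?w ?w * mat_adjoint (1\<^sub>m dA \<otimes>\<^sub>m K))"
  have *: "?r Kp \<in> carrier_mat 16 16 \<and> 0 \<le> gap (?r Kp)" if Kp: "Kp \<in> set br" for Kp
  proof -
    obtain K p where Kpe: "Kp = (K, p)" by (cases Kp)
    have K: "dim_col K = dB" "locc_wf p dA (dim_row K)" using 3 Kp Kpe by auto
    have "(1\<^sub>m dA \<otimes>\<^sub>m K) * ketbra ?w ?w * mat_adjoint (1\<^sub>m dA \<otimes>\<^sub>m K)
        = ketbra ((1\<^sub>m dA \<otimes>\<^sub>m K) *\<^sub>v ?w) ((1\<^sub>m dA \<otimes>\<^sub>m K) *\<^sub>v ?w)"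
      by (rule conjugate_ketbra[of _ "dA * dim_row K" "dA * dB"])
        (use K 3 in \<open>auto intro!: carrier_matI carrier_vecI\<close>)
    also have "(1\<^sub>m dA \<otimes>\<^sub>m K) *\<^sub>v ?w = u \<otimes>\<^sub>v (K *\<^sub>v v)"
      using K 3(3,4) by (subst tensor_mat_mult_tensor_vec) auto
    finally have eq: "(1\<^sub>m dA \<otimes>\<^sub>m K) * ketbra ?w ?w * mat_adjoint (1\<^sub>m dA \<otimes>\<^sub>m K)
        = ketbra (u \<otimes>\<^sub>v (K *\<^sub>v v)) (u \<otimes>\<^sub>v (K *\<^sub>v v))" .
    have "K *\<^sub>v v \<in> carrier_vec (dim_row K)" by (rule carrier_vecI) simp
    from 3(1)[OF Kp Kpe[symmetric] K(2) 3(3) this] show ?thesis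
      unfolding Kpe prod.case eq .
  qed
  have run: "locc_run (Bob br) dA dB (ketbra ?w ?w) = msum 16 16 (map ?r br)"
    by simp
  have "gap (msum 16 16 (map ?r br)) = sum_list (map gap (map ?r br))"
    by (rule gap_msum) (use * in auto)
  moreover have "0 \<le> sum_list (map gap (map ?r br))"
    by (intro sum_list_nonneg) (use * in auto)
  ultimately show ?case
    unfolding run by (simp add: msum_def)
qed

section \<open>Bell mixtures\<close>

lemma tr_relabel_regroup:
  "X \<in> carrier_mat 16 16 \<Longrightarrow> tr (relabel 16 regroup_index (\<lambda>_. True) X) = tr X"
  unfolding tr_def
  by (rule sum.reindex_bij_witness[of _ regroup_index regroup_index])
    (auto simp: regroup_index_less regroup_index_involution)

text \<open>Pairs in \<open>|ss>\<close> and \<open>|tt>\<close> leave each party with one copy of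
  \<open>s\<close> and one of \<open>t\<close>, so the joint state is a product between the
  parties.\<close>

lemma relabel_regroup_product:
  assumes s: "s \<in> carrier_vec 2" and t: "t \<in> carrier_vec 2"
  shows "relabel 16 regroup_index (\<lambda>_. True)
      (ketbra ((s \<otimes>\<^sub>v s) \<otimes>\<^sub>v (t \<otimes>\<^sub>v t)) ((s \<otimes>\<^sub>v s) \<otimes>\<^sub>v (t \<otimes>\<^sub>v t)))
    = ketbra ((s \<otimes>\<^sub>v t) \<otimes>\<^sub>v (s \<otimes>\<^sub>v t)) ((s \<otimes>\<^sub>v t) \<otimes>\<^sub>v (s \<otimes>\<^sub>v t))"
proof -
  have d: "dim_vec s = 2" "dim_vec t = 2" using s t by auto
  have "((s \<otimes>\<^sub>v s) \<otimes>\<^sub>v (t \<otimes>\<^sub>v t)) $ regroup_index i = ((s \<otimes>\<^sub>v t) \<otimes>\<^sub>v (s \<otimes>\<^sub>v t)) $ i" if "i < 16" for i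
    using that by (drule_tac less_16_cases[THEN iffD1], elim disjE; simp add: regroup_index_def d)
  then show ?thesis
    by (intro eq_matI) (auto simp: d regroup_index_less simp del: index_tensor_vec(1))
qed

lemma locc_product_fidelity:
  assumes D: "locc_implementable D" and s: "s \<in> carrier_vec 2" and t: "t \<in> carrier_vec 2"
  defines "X \<equiv> ketbra ((s \<otimes>\<^sub>v s) \<otimes>\<^sub>v (t \<otimes>\<^sub>v t)) ((s \<otimes>\<^sub>v s) \<otimes>\<^sub>v (t \<otimes>\<^sub>v t))"
  shows "2 * fidelity (ptrace34 (D X)) \<le> Re (tr (D X))"
proof -
  obtain p where p: "locc_wf p 4 4"
    "\<And>X. X \<in> carrier_mat 16 16 \<Longrightarrow> D X = regroup * locc_run p 4 4 (regroup * X * regroup) * regroup"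
    using D unfolding locc_implementable_def by blast
  let ?u = "s \<otimes>\<^sub>v t"
  let ?Y = "locc_run p 4 4 (ketbra (?u \<otimes>\<^sub>v ?u) (?u \<otimes>\<^sub>v ?u))"
  have "?u \<in> carrier_vec 4" using s t by (intro carrier_vecI) simp
  then have Y: "?Y \<in> carrier_mat 16 16" "0 \<le> gap ?Y"
    using locc_run_product[OF p(1)] by blast+
  have X: "X \<in> carrier_mat 16 16" using s t by (auto simp: X_def)
  have "D X = relabel 16 regroup_index (\<lambda>_. True) ?Y"
    unfolding p(2)[OF X] regroup_conjugate[OF X]
    unfolding X_def relabel_regroup_product[OF s t] by (rule regroup_conjugate[OF Y(1)])
  then show ?thesis
    using Y(2) tr_relabel_regroup[OF Y(1)] by (simp add: gap_def)
qed

text \<open>This is complete positivity with an ancilla of dimension 1.\<close>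

lemma completely_positive_psd:
  assumes "completely_positive n D" "linear_map_mat n D" "psd n X"
  shows "psd n (D X)"
proof -
  have X: "X \<in> carrier_mat n n" using assms(3) by (rule psd_carrier)
  have "mat n n (\<lambda>(s, t). X $$ (s * 1 + 0, t * 1 + 0)) = X" using X by (intro eq_matI) auto
  moreover have "D X \<in> carrier_mat n n" using assms(2) X by (simp add: linear_map_mat_def)
  ultimately have "ampliate n 1 D X = D X"
    by (intro eq_matI) (auto simp: ampliate_def)
  moreover have "psd (n * 1) (ampliate n 1 D X)"
    using assms(1,3) unfolding completely_positive_def by (metis mult.right_neutral)
  ultimately show ?thesis by simp
qed

section \<open>Bell states and their mixtures\<close>

definition Psi_plus :: "complex vec" where
  "Psi_plus = complex_of_real (1 / sqrt 2) \<cdot>\<^sub>v (ket 0 \<otimes>\<^sub>v ket 1 + ket 1 \<otimes>\<^sub>v ket 0)"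

text \<open>The family that the algorithm stays in. The parameter is the difference of the two
  weights and also the coherence between \<open>|++>\<close> and \<open>|-->\<close>, which makes it
  the \<open>|R|\<close> of a prepared pair.\<close>

definition bell_mixture :: "real \<Rightarrow> complex mat" where
  "bell_mixture r = complex_of_real ((1 + r) / 2) \<cdot>\<^sub>m ketbra Phi_plus Phi_plus
     + complex_of_real ((1 - r) / 2) \<cdot>\<^sub>m ketbra Psi_plus Psi_plus"

lemma dim_Psi_plus [simp]: "dim_vec Psi_plus = 4"
  by (simp add: Psi_plus_def)

lemma index_Psi_plus:
  "i < 4 \<Longrightarrow> Psi_plus $ i = (if i = 1 \<or> i = 2 then complex_of_real (1 / sqrt 2) else 0)"
  by (drule less_4_cases[THEN iffD1], elim disjE; simp add: Psi_plus_def)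

lemma sqrt2_square: "complex_of_real (sqrt 2) * complex_of_real (sqrt 2) = 2"
  by (simp flip: of_real_mult)

lemma index_bell_mixture:
  assumes "i < 4" "j < 4"
  shows "bell_mixture r $$ (i, j) = complex_of_real
    (if (i = 0 \<or> i = 3) \<and> (j = 0 \<or> j = 3) then (1 + r) / 4
     else if (i = 1 \<or> i = 2) \<and> (j = 1 \<or> j = 2) then (1 - r) / 4 else 0)"
  using assms sqrt2_square by (auto simp: bell_mixture_def index_Phi_plus index_Psi_plus)

lemma bell_mixture_dim [simp]: "dim_row (bell_mixture r) = 4" "dim_col (bell_mixture r) = 4"
  by (simp_all add: bell_mixture_def)

lemma bell_mixture_carrier: "bell_mixture r \<in> carrier_mat 4 4"
  by auto

lemma psd_bell_mixture: "0 \<le> r \<Longrightarrow> r \<le> 1 \<Longrightarrow> psd 4 (bell_mixture r)"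
  unfolding bell_mixture_def
  by (intro psd_add psd_smult psd_ketbra) (auto intro!: carrier_vecI)

lemma ket_plus_index [simp]: "i < 2 \<Longrightarrow> ket_plus $ i = complex_of_real (1 / sqrt 2)" "dim_vec ket_plus = 2"
  by (auto simp: ket_plus_def less_2_cases_iff)

lemma ket_minus_index [simp]:
  "i < 2 \<Longrightarrow> ket_minus $ i = (if i = 0 then complex_of_real (1 / sqrt 2) else - complex_of_real (1 / sqrt 2))"
  "dim_vec ket_minus = 2"
  by (auto simp: ket_minus_def less_2_cases_iff)

lemma index_plus_plus: "i < 4 \<Longrightarrow> (ket_plus \<otimes>\<^sub>v ket_plus) $ i = 1 / 2"
  using sqrt2_square by (simp add: less_mult_imp_div_less)

lemma index_minus_minus:
  "i < 4 \<Longrightarrow> (ket_minus \<otimes>\<^sub>v ket_minus) $ i = (if i = 0 \<or> i = 3 then 1 / 2 else - (1 / 2))"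
  using sqrt2_square by (drule_tac less_4_cases[THEN iffD1], elim disjE; simp)

text \<open>\<open>Phi_plus\<close> and \<open>Psi_plus\<close> are the sum and the difference of
  \<open>|++>\<close> and \<open>|-->\<close>, divided by \<open>sqrt 2\<close>.\<close>

lemma bell_mixture_two_kraus_state:
  "two_kraus_state ket_plus ket_minus ket_plus ket_minus 0 (complex_of_real r) = bell_mixture r"
  by (rule eq_matI; simp add: two_kraus_state_def index_bell_mixture index_plus_plus index_minus_minus del: index_tensor_vec(1))

text \<open>Both sides are the projection onto the same plane, written in an entangled and in a
  product basis. This is the link by which the bound for product states reaches the Bell
  states.\<close>

lemma bell_completeness:
  "ketbra Phi_plus Phi_plus + ketbra Psi_plus Psi_plus =
   ketbra (ket_plus \<otimes>\<^sub>v ket_plus) (ket_plus \<otimes>\<^sub>v ket_plus) + ketbra (ket_minus \<otimes>\<^sub>v ket_minus) (ket_minus \<otimes>\<^sub>v ket_minus)"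
  using sqrt2_square
  by (intro eq_matI; simp add: index_plus_plus index_minus_minus index_Phi_plus index_Psi_plus del: index_tensor_vec(1))
    (auto simp: less_4_cases)

section \<open>Bounds for an arbitrary distillation operation\<close>

lemma distillation_lp:
  fixes a m b :: real
  assumes "0 \<le> a" "a \<le> m" "m \<le> b"
    and "0 \<le> p1" "0 \<le> p2" "0 \<le> p3" "0 \<le> p4" "0 \<le> q1" "0 \<le> q2" "0 \<le> q3" "0 \<le> q4"
    and "p1 + p2 + p3 + p4 \<le> q1 + q2 + q3 + q4"
  shows "a * (b * p1 + m * p2 + m * p3 + a * p4) \<le> b * (b * q1 + m * q2 + m * q3 + a * q4)"
    and "0 < a \<Longrightarrow> a < m \<Longrightarrow> m < b \<Longrightarrow>
      a * (b * p1 + m * p2 + m * p3 + a * p4) = b * (b * q1 + m * q2 + m * q3 + a * q4) \<Longrightarrow>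
      p2 = 0 \<and> p3 = 0 \<and> p4 = 0 \<and> q1 = 0 \<and> q2 = 0 \<and> q3 = 0 \<and> p1 = q4"
proof -
  \<comment> \<open>The slack of the claimed inequality is a sum of three nonnegative terms:
    \<open>?P\<close> from success probability on products below the largest weight,
    \<open>?Q\<close> from failure of fidelity above the smallest weight, and \<open>?S\<close> from
    the LOCC constraint. Equality makes each of them vanish.\<close>
  let ?P = "a * ((b - m) * p2 + (b - m) * p3 + (b - a) * p4)"
  let ?Q = "b * ((b - a) * q1 + (m - a) * q2 + (m - a) * q3)"
  let ?S = "a * b * (q1 + q2 + q3 + q4 - (p1 + p2 + p3 + p4))"
  have eq: "b * (b * q1 + m * q2 + m * q3 + a * q4) - a * (b * p1 + m * p2 + m * p3 + a * p4) = ?P + ?Q + ?S"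
    by (simp add: algebra_simps)
  have nn: "0 \<le> ?P" "0 \<le> ?Q" "0 \<le> ?S"
    using assms by (auto intro!: mult_nonneg_nonneg add_nonneg_nonneg)
  show "a * (b * p1 + m * p2 + m * p3 + a * p4) \<le> b * (b * q1 + m * q2 + m * q3 + a * q4)"
    using eq nn by linarith
  assume s: "0 < a" "a < m" "m < b"
    and e: "a * (b * p1 + m * p2 + m * p3 + a * p4) = b * (b * q1 + m * q2 + m * q3 + a * q4)"
  have z: "?P = 0" "?Q = 0" using eq nn e by linarith+
  have nn2: "0 \<le> (b - m) * p2" "0 \<le> (b - m) * p3" "0 \<le> (b - a) * p4"
     "0 \<le> (b - a) * q1" "0 \<le> (m - a) * q2" "0 \<le> (m - a) * q3"
    using assms s by simp_all
  have "(b - m) * p2 + (b - m) * p3 + (b - a) * p4 = 0" "(b - a) * q1 + (m - a) * q2 + (m - a) * q3 = 0"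
    using z s by simp_all
  then have "(b - m) * p2 = 0" "(b - m) * p3 = 0" "(b - a) * p4 = 0"
     "(b - a) * q1 = 0" "(m - a) * q2 = 0" "(m - a) * q3 = 0"
    using nn2 by linarith+
  then have 0: "p2 = 0" "p3 = 0" "p4 = 0" "q1 = 0" "q2 = 0" "q3 = 0" using s by auto
  \<comment> \<open>What remains of \<open>e\<close> is \<open>a * b * p1 = b * a * q4\<close>, with
    \<open>a\<close> and \<open>b\<close> positive.\<close>
  then show "p2 = 0 \<and> p3 = 0 \<and> p4 = 0 \<and> q1 = 0 \<and> q2 = 0 \<and> q3 = 0 \<and> p1 = q4"
    using e s by auto
qed

lemma tr_tensor: 
  assumes "A \<in> carrier_mat n n" "B \<in> carrier_mat m m"
  shows "tr (A \<otimes>\<^sub>m B) = tr A * tr B"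
proof -
  have "tr (A \<otimes>\<^sub>m B) = (\<Sum>k<n * m. A $$ (k div m, k div m) * B $$ (k mod m, k mod m))"
    using assms by (auto simp: tr_def)
  also have "\<dots> = (\<Sum>a<n. \<Sum>b<m. A $$ (a, a) * B $$ (b, b))"
    by (rule sum_div_mod)
  finally show ?thesis
    using assms by (auto simp: tr_def sum_product)
qed

lemma tensor_binomial:
  assumes "A \<in> carrier_mat n n" "B \<in> carrier_mat n n"
  shows "(x \<cdot>\<^sub>m A + y \<cdot>\<^sub>m B) \<otimes>\<^sub>m (x \<cdot>\<^sub>m A + y \<cdot>\<^sub>m B) =
    (x * x) \<cdot>\<^sub>m (A \<otimes>\<^sub>m A) + ((x * y) \<cdot>\<^sub>m (A \<otimes>\<^sub>m B) + ((x * y) \<cdot>\<^sub>m (B \<otimes>\<^sub>m A) + (y * y) \<cdot>\<^sub>m (B \<otimes>\<^sub>m B)))"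
  using assms
  by (intro eq_matI) (auto simp: div_less_of_less_mult mod_less_of_less_mult algebra_simps)

lemma tensor_add_square:
  assumes "A \<in> carrier_mat n n" "B \<in> carrier_mat n n"
  shows "(A + B) \<otimes>\<^sub>m (A + B) = A \<otimes>\<^sub>m A + (A \<otimes>\<^sub>m B + (B \<otimes>\<^sub>m A + B \<otimes>\<^sub>m B))"
  using assms
  by (intro eq_matI) (auto simp: div_less_of_less_mult mod_less_of_less_mult algebra_simps)

text \<open>Here \<open>T\<close> is the success probability and \<open>F\<close> the fidelity
  before normalization. The bound on \<open>F / T\<close> is stated without division, so it also
  makes sense for \<open>T = 0\<close>.\<close>

lemma distillation_bounds:
  assumes D: "distillation_op D" and r: "0 < r" "r \<le> 1"
  defines "T \<equiv> Re (tr (D (bell_mixture r \<otimes>\<^sub>m bell_mixture r)))"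
    and "F \<equiv> fidelity (ptrace34 (D (bell_mixture r \<otimes>\<^sub>m bell_mixture r)))"
  shows "F * (2 * (1 + r\<^sup>2)) \<le> (1 + r)\<^sup>2 * T"
    and "F * (2 * (1 + r\<^sup>2)) = (1 + r)\<^sup>2 * T \<Longrightarrow> T \<le> (1 + r\<^sup>2) / 2"
proof -
  have lin: "linear_map_mat 16 D" and cp: "completely_positive 16 D"
    and ti: "trace_nonincreasing 16 D" and locc: "locc_implementable D"
    using D by (auto simp: distillation_op_def quantum_operation_def)
  \<comment> \<open>Fidelity before normalization and success probability as functions of the input.
    Both are linear over the reals, so they can be evaluated on any decomposition of the joint
    state.\<close>
  define f where "f X = fidelity (ptrace34 (D X))" for X
  define t where "t X = Re (tr (D X))" for X
  have Dc: "D X \<in> carrier_mat 16 16" if "X \<in> carrier_mat 16 16" for X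
    using lin that by (simp add: linear_map_mat_def)
  have add: "f (X + Y) = f X + f Y" "t (X + Y) = t X + t Y"
    if "X \<in> carrier_mat 16 16" "Y \<in> carrier_mat 16 16" for X Y
  proof -
    have "D (X + Y) = D X + D Y" using lin that by (simp add: linear_map_mat_def)
    then show "f (X + Y) = f X + f Y" "t (X + Y) = t X + t Y"
      using Dc[OF that(1)] Dc[OF that(2)]
      by (simp_all add: f_def t_def fidelity_ptrace34_entries tr_def sum.distrib add_divide_distrib)
  qed
  have smult: "f (complex_of_real c \<cdot>\<^sub>m X) = c * f X" "t (complex_of_real c \<cdot>\<^sub>m X) = c * t X"
    if "X \<in> carrier_mat 16 16" for c X
  proof -
    have "D (complex_of_real c \<cdot>\<^sub>m X) = complex_of_real c \<cdot>\<^sub>m D X"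
      using lin that by (simp add: linear_map_mat_def)
    then show "f (complex_of_real c \<cdot>\<^sub>m X) = c * f X" "t (complex_of_real c \<cdot>\<^sub>m X) = c * t X"
      using Dc[OF that]
      by (simp_all add: f_def t_def fidelity_ptrace34_entries tr_def sum_distrib_left ring_distribs)
  qed
  have bd: "0 \<le> f X" "f X \<le> t X" "t X \<le> Re (tr X)" if X: "psd 16 X" for X
  proof -
    have DX: "psd 16 (D X)" using cp lin X by (rule completely_positive_psd)
    then have "psd 4 (ptrace34 (D X))" by (rule psd_ptrace34)
    then show "0 \<le> f X" "f X \<le> t X"
      using fidelity_nonneg fidelity_le_trace tr_ptrace34[OF psd_carrier[OF DX]] by (force simp: f_def t_def)+
    show "t X \<le> Re (tr X)" using ti X by (simp add: t_def trace_nonincreasing_def)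
  qed
  let ?P = "ketbra Phi_plus Phi_plus" and ?Q = "ketbra Psi_plus Psi_plus"
  have c4: "?P \<in> carrier_mat 4 4" "?Q \<in> carrier_mat 4 4" by auto
  have c16: "X \<otimes>\<^sub>m Y \<in> carrier_mat 16 16" if "X \<in> carrier_mat 4 4" "Y \<in> carrier_mat 4 4" for X Y
    using that by auto
  have tr1: "tr ?P = 1" "tr ?Q = 1"
    using sqrt2_square by (simp_all add: tr_def sum_lessThan_4 index_Phi_plus index_Psi_plus)
  have bell: "0 \<le> f X" "f X \<le> t X" "t X \<le> 1" if "X \<in> {?P \<otimes>\<^sub>m ?P, ?P \<otimes>\<^sub>m ?Q, ?Q \<otimes>\<^sub>m ?P, ?Q \<otimes>\<^sub>m ?Q}" for X
  proof -
    have "psd 16 X"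
      using that by (auto simp: tensor_ketbra intro!: psd_ketbra carrier_vecI)
    moreover have "tr X = 1"
      using that c4 by (auto simp: tr_tensor[of _ 4 _ 4] tr1 simp del: index_ketbra)
    ultimately show "0 \<le> f X" "f X \<le> t X" "t X \<le> 1" using bd[of X] by auto
  qed
  let ?p = "ket_plus \<otimes>\<^sub>v ket_plus" and ?m = "ket_minus \<otimes>\<^sub>v ket_minus"
  let ?A = "ketbra ?p ?p" and ?B = "ketbra ?m ?m"
  have cAB: "?A \<in> carrier_mat 4 4" "?B \<in> carrier_mat 4 4" by auto
  have kc: "ket_plus \<in> carrier_vec 2" "ket_minus \<in> carrier_vec 2" by (auto intro!: carrier_vecI)
  have prod: "2 * f (?A \<otimes>\<^sub>m ?A) \<le> t (?A \<otimes>\<^sub>m ?A)" "2 * f (?A \<otimes>\<^sub>m ?B) \<le> t (?A \<otimes>\<^sub>m ?B)"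
    "2 * f (?B \<otimes>\<^sub>m ?A) \<le> t (?B \<otimes>\<^sub>m ?A)" "2 * f (?B \<otimes>\<^sub>m ?B) \<le> t (?B \<otimes>\<^sub>m ?B)"
    unfolding f_def t_def tensor_ketbra by (intro locc_product_fidelity locc kc)+
  \<comment> \<open>Completeness, tensored with itself: the four Bell products and the four products
    of \<open>|++>\<close> and \<open>|-->\<close> have the same sum.\<close>
  have "(?P + ?Q) \<otimes>\<^sub>m (?P + ?Q) = (?A + ?B) \<otimes>\<^sub>m (?A + ?B)"
    unfolding bell_completeness ..
  then have E: "?P \<otimes>\<^sub>m ?P + (?P \<otimes>\<^sub>m ?Q + (?Q \<otimes>\<^sub>m ?P + ?Q \<otimes>\<^sub>m ?Q)) =
      ?A \<otimes>\<^sub>m ?A + (?A \<otimes>\<^sub>m ?B + (?B \<otimes>\<^sub>m ?A + ?B \<otimes>\<^sub>m ?B))"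
    unfolding tensor_add_square[OF c4] tensor_add_square[OF cAB] .
  \<comment> \<open>Arithmetic over free variables: if two decompositions have equal sums, the
    termwise bounds on one give the summed bound on the other.\<close>
  have aux: "2 * (x1 + x2 + x3 + x4) \<le> y1 + y2 + y3 + y4"
    if "x1 + (x2 + (x3 + x4)) = u1 + (u2 + (u3 + u4))" "y1 + (y2 + (y3 + y4)) = v1 + (v2 + (v3 + v4))"
      "2 * u1 \<le> v1" "2 * u2 \<le> v2" "2 * u3 \<le> v3" "2 * u4 \<le> v4"
    for x1 x2 x3 x4 y1 y2 y3 y4 u1 u2 u3 u4 v1 v2 v3 v4 :: real
  proof -
    have "2 * (x1 + x2 + x3 + x4) = 2 * (u1 + (u2 + (u3 + u4)))"
      unfolding that(1)[symmetric] by simp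
    also have "\<dots> \<le> v1 + (v2 + (v3 + v4))"
      using add_mono[OF that(3) add_mono[OF that(4) add_mono[OF that(5) that(6)]]] by simp
    also have "\<dots> = y1 + y2 + y3 + y4"
      unfolding that(2)[symmetric] by simp
    finally show ?thesis .
  qed
  have sum_le: "2 * (f (?P \<otimes>\<^sub>m ?P) + f (?P \<otimes>\<^sub>m ?Q) + f (?Q \<otimes>\<^sub>m ?P) + f (?Q \<otimes>\<^sub>m ?Q))
      \<le> t (?P \<otimes>\<^sub>m ?P) + t (?P \<otimes>\<^sub>m ?Q) + t (?Q \<otimes>\<^sub>m ?P) + t (?Q \<otimes>\<^sub>m ?Q)"
  proof (rule aux[OF _ _ prod])
    show "f (?P \<otimes>\<^sub>m ?P) + (f (?P \<otimes>\<^sub>m ?Q) + (f (?Q \<otimes>\<^sub>m ?P) + f (?Q \<otimes>\<^sub>m ?Q))) =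
        f (?A \<otimes>\<^sub>m ?A) + (f (?A \<otimes>\<^sub>m ?B) + (f (?B \<otimes>\<^sub>m ?A) + f (?B \<otimes>\<^sub>m ?B)))"
      using arg_cong[OF E, of f] by (simp only: add c16 c4 cAB add_carrier_mat)
    show "t (?P \<otimes>\<^sub>m ?P) + (t (?P \<otimes>\<^sub>m ?Q) + (t (?Q \<otimes>\<^sub>m ?P) + t (?Q \<otimes>\<^sub>m ?Q))) =
        t (?A \<otimes>\<^sub>m ?A) + (t (?A \<otimes>\<^sub>m ?B) + (t (?B \<otimes>\<^sub>m ?A) + t (?B \<otimes>\<^sub>m ?B)))"
      using arg_cong[OF E, of t] by (simp only: add c16 c4 cAB add_carrier_mat)
  qed
  let ?x = "(1 + r) / 2" and ?y = "(1 - r) / 2"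
  have \<sigma>: "bell_mixture r \<otimes>\<^sub>m bell_mixture r = complex_of_real (?x * ?x) \<cdot>\<^sub>m (?P \<otimes>\<^sub>m ?P)
     + (complex_of_real (?x * ?y) \<cdot>\<^sub>m (?P \<otimes>\<^sub>m ?Q)
     + (complex_of_real (?x * ?y) \<cdot>\<^sub>m (?Q \<otimes>\<^sub>m ?P) + complex_of_real (?y * ?y) \<cdot>\<^sub>m (?Q \<otimes>\<^sub>m ?Q)))"
    unfolding bell_mixture_def of_real_mult by (rule tensor_binomial[OF c4])
  \<comment> \<open>Four times the weights of the Bell products in the joint state, in increasing
    order.\<close>
  let ?a = "(1 - r)\<^sup>2" and ?m = "1 - r\<^sup>2" and ?b = "(1 + r)\<^sup>2"
  define p1 p2 p3 p4 where "p1 = f (?P \<otimes>\<^sub>m ?P)" and "p2 = f (?P \<otimes>\<^sub>m ?Q)" and "p3 = f (?Q \<otimes>\<^sub>m ?P)" and "p4 = f (?Q \<otimes>\<^sub>m ?Q)"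
  define t1 t2 t3 t4 where "t1 = t (?P \<otimes>\<^sub>m ?P)" and "t2 = t (?P \<otimes>\<^sub>m ?Q)" and "t3 = t (?Q \<otimes>\<^sub>m ?P)" and "t4 = t (?Q \<otimes>\<^sub>m ?Q)"
  note pt = p1_def p2_def p3_def p4_def t1_def t2_def t3_def t4_def
  have "F = ?x * ?x * p1 + (?x * ?y * p2 + (?x * ?y * p3 + ?y * ?y * p4))"
    unfolding F_def pt f_def[symmetric] \<sigma>
    by (simp only: add smult c16 c4 add_carrier_mat smult_carrier_mat)
  then have F: "4 * F = ?b * p1 + ?m * p2 + ?m * p3 + ?a * p4"
    by (simp add: field_simps power2_eq_square)
  have "T = ?x * ?x * t1 + (?x * ?y * t2 + (?x * ?y * t3 + ?y * ?y * t4))"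
    unfolding T_def pt t_def[symmetric] \<sigma>
    by (simp only: add smult c16 c4 add_carrier_mat smult_carrier_mat)
  then have T: "4 * T = ?b * t1 + ?m * t2 + ?m * t3 + ?a * t4"
    by (simp add: field_simps power2_eq_square)
  have nn: "0 \<le> p1" "0 \<le> p2" "0 \<le> p3" "0 \<le> p4" "0 \<le> t1 - p1" "0 \<le> t2 - p2" "0 \<le> t3 - p3" "0 \<le> t4 - p4"
    "t1 \<le> 1" "t2 \<le> 1" "t3 \<le> 1" "t4 \<le> 1"
    using bell by (auto simp: pt)
  have le: "p1 + p2 + p3 + p4 \<le> (t1 - p1) + (t2 - p2) + (t3 - p3) + (t4 - p4)"
    using sum_le by (simp add: pt)
  \<comment> \<open>The differences \<open>t1 - p1\<close> to \<open>t4 - p4\<close> are the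
    \<open>q1\<close> to \<open>q4\<close> of the linear program.\<close>
  have TF: "4 * (T - F) = ?b * (t1 - p1) + ?m * (t2 - p2) + ?m * (t3 - p3) + ?a * (t4 - p4)"
    using F T by (simp add: algebra_simps)
  have r2: "r\<^sup>2 \<le> r" using r by (simp add: power2_eq_square mult_left_le)
  have am: "0 \<le> ?a" by simp
  have mb: "?a \<le> ?m" "?m \<le> ?b"
    using r r2 by (simp_all add: power2_sum power2_diff)
  have "?a * (4 * F) \<le> ?b * (4 * (T - F))"
    unfolding F TF by (rule distillation_lp(1)[OF am mb nn(1-8) le])
  \<comment> \<open>Adding \<open>?b * F\<close> on both sides turns the bound of the linear program
    into the claim.\<close>
  moreover have ab: "?a + ?b = 2 * (1 + r\<^sup>2)" by (simp add: power2_sum power2_diff)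
  ultimately show "F * (2 * (1 + r\<^sup>2)) \<le> (1 + r)\<^sup>2 * T"
    unfolding ab[symmetric] by (simp add: algebra_simps)
  assume eq: "F * (2 * (1 + r\<^sup>2)) = (1 + r)\<^sup>2 * T"
  show "T \<le> (1 + r\<^sup>2) / 2"
  proof (cases "r = 1")
    case True
    \<comment> \<open>Only the product of largest weight occurs for \<open>r = 1\<close>, and the
      bound is just \<open>T \<le> 1\<close>.\<close>
    then show ?thesis using T nn by simp
  next
    case False
    then have r': "0 < 1 - r" "r\<^sup>2 < r" using r by (simp_all add: power2_eq_square)
    from r'(1) have s: "0 < ?a" by simp
    have s': "?a < ?m" "?m < ?b"
      using r r' by (simp_all add: power2_sum power2_diff add_pos_nonneg)
    have "?a * (4 * F) = ?b * (4 * (T - F))"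
      using eq unfolding ab[symmetric] by (simp add: algebra_simps)
    then have "p2 = 0 \<and> p3 = 0 \<and> p4 = 0 \<and> t1 - p1 = 0 \<and> t2 - p2 = 0 \<and> t3 - p3 = 0 \<and> p1 = t4 - p4"
      unfolding F TF by (rule distillation_lp(2)[OF am mb nn(1-8) le s s'])
    \<comment> \<open>Only \<open>t1\<close> and \<open>t4\<close> survive, and they
      coincide.\<close>
    then have "4 * T = (?a + ?b) * t4" using T by (simp add: algebra_simps)
    also have "\<dots> \<le> (?a + ?b) * 1"
      using nn by (intro mult_left_mono) simp_all
    finally show ?thesis unfolding ab by simp
  qed
qed

section \<open>Rounds of the algorithm\<close>

lemma psd_bell_mixture_tensor:
  assumes "0 \<le> r" "r \<le> 1"
  shows "psd 16 (bell_mixture r \<otimes>\<^sub>m bell_mixture r)"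
proof -
  have c: "ketbra Phi_plus Phi_plus \<in> carrier_mat 4 4" "ketbra Psi_plus Psi_plus \<in> carrier_mat 4 4" by auto
  show ?thesis
    unfolding bell_mixture_def tensor_binomial[OF c] tensor_ketbra of_real_mult[symmetric]
    using assms by (intro psd_add psd_smult psd_ketbra) (auto intro!: carrier_vecI)
qed

text \<open>A round squares the entries of the state. The factor 2 counts the agreeing results, and
  \<open>(1 + r\<^sup>2) / 2\<close> is the probability of keeping the pair, split off as
  normalization.\<close>

lemma bell_parameter_step:
  fixes r :: real
  shows "2 * ((1 + r) / 4 * ((1 + r) / 4)) = (1 + r\<^sup>2) / 2 * ((1 + 2 * r / (1 + r\<^sup>2)) / 4)"
    and "2 * ((1 - r) / 4 * ((1 - r) / 4)) = (1 + r\<^sup>2) / 2 * ((1 - 2 * r / (1 + r\<^sup>2)) / 4)"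
proof -
  have "0 < 1 + r\<^sup>2" by (simp add: add_pos_nonneg)
  then have "1 + r\<^sup>2 \<noteq> 0" by simp
  then show "2 * ((1 + r) / 4 * ((1 + r) / 4)) = (1 + r\<^sup>2) / 2 * ((1 + 2 * r / (1 + r\<^sup>2)) / 4)"
    "2 * ((1 - r) / 4 * ((1 - r) / 4)) = (1 + r\<^sup>2) / 2 * ((1 - 2 * r / (1 + r\<^sup>2)) / 4)"
    by (simp_all add: field_simps power2_eq_square)
qed

lemma ptrace34_agree_op:
  "ptrace34 (agree_op (bell_mixture r \<otimes>\<^sub>m bell_mixture r)) =
   complex_of_real ((1 + r\<^sup>2) / 2) \<cdot>\<^sub>m bell_mixture (2 * r / (1 + r\<^sup>2))"
proof (rule eq_matI)
  let ?r = "2 * r / (1 + r\<^sup>2)"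
  let ?X = "agree_op (bell_mixture r \<otimes>\<^sub>m bell_mixture r)"
  let ?g = "\<lambda>i j. bell_mixture r $$ (i, j)"
  fix i j assume "i < dim_row (complex_of_real ((1 + r\<^sup>2) / 2) \<cdot>\<^sub>m bell_mixture ?r)"
    "j < dim_col (complex_of_real ((1 + r\<^sup>2) / 2) \<cdot>\<^sub>m bell_mixture ?r)"
  then have ij: "i < 4" "j < 4" by auto
  \<comment> \<open>The target states 1 and 2 are the disagreeing results, on which
    \<open>agree_op\<close> vanishes.\<close>
  have "ptrace34 ?X $$ (i, j) = ?X $$ (i * 4, j * 4) + ?X $$ (i * 4 + 3, j * 4 + 3)"
  proof -
    have "Suc (l * 4) mod 4 = 1" "Suc (Suc (l * 4)) mod 4 = 2" for l by presburger+
    then show ?thesis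
      using ij by (simp add: ptrace34_def sum_lessThan_4 index_agree_op)
  qed
  \<comment> \<open>With result 0 the target bits before the CNOT gates equal the source bits, which
    gives the square of entry \<open>(i, j)\<close>. With result 1 they are the complements, and
    entry \<open>(3 - i, 3 - j)\<close> of a Bell mixture equals entry
    \<open>(i, j)\<close>.\<close>
  also have "\<dots> = 2 * (?g i j * ?g i j)"
  proof -
    have "i = 0 \<or> i = 1 \<or> i = 2 \<or> i = 3" "j = 0 \<or> j = 1 \<or> j = 2 \<or> j = 3"
      using ij by (simp_all add: less_4_cases)
    then show ?thesis
      by (elim disjE) (simp_all add: index_agree_op cnots_index_def index_bell_mixture)
  qed
  also have "\<dots> = complex_of_real ((1 + r\<^sup>2) / 2) * bell_mixture ?r $$ (i, j)"
  proof -
    \<comment> \<open>One case distinction serves both parameters: an entry of the even-parity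
      block, of the odd-parity block, or zero.\<close>
    define e where "e s = (if (i = 0 \<or> i = 3) \<and> (j = 0 \<or> j = 3) then (1 + s) / 4
      else if (i = 1 \<or> i = 2) \<and> (j = 1 \<or> j = 2) then (1 - s) / 4 else 0)" for s :: real
    have g: "bell_mixture s $$ (i, j) = complex_of_real (e s)" for s
      unfolding e_def using ij by (rule index_bell_mixture)
    have "e r = (1 + r) / 4 \<and> e ?r = (1 + ?r) / 4 \<or> e r = (1 - r) / 4 \<and> e ?r = (1 - ?r) / 4 \<or> e r = 0 \<and> e ?r = 0"
      by (simp add: e_def)
    then have "2 * (e r * e r) = (1 + r\<^sup>2) / 2 * e ?r"
      by (elim disjE conjE; simp only: bell_parameter_step mult_zero_right)
    from arg_cong[OF this, of complex_of_real] show ?thesis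
      unfolding g by (simp only: of_real_mult of_real_numeral)
  qed
  finally show "ptrace34 ?X $$ (i, j) = (complex_of_real ((1 + r\<^sup>2) / 2) \<cdot>\<^sub>m bell_mixture ?r) $$ (i, j)"
    using ij by simp
qed auto

lemma tr_bell_mixture: "tr (bell_mixture r) = 1"
  by (simp add: tr_def sum_lessThan_4 index_bell_mixture complex_eq_iff) (simp add: field_simps)

lemma fidelity_bell_mixture: "fidelity (bell_mixture r) = (1 + r) / 2"
  unfolding fidelity_entries[OF bell_mixture_carrier] by (simp add: index_bell_mixture add_divide_distrib)

lemma tr_smult: "tr (c \<cdot>\<^sub>m M) = c * tr M" if "M \<in> carrier_mat n n"
  using that by (auto simp: tr_def sum_distrib_left)

lemma tr_agree_op: "tr (agree_op (bell_mixture r \<otimes>\<^sub>m bell_mixture r)) = complex_of_real ((1 + r\<^sup>2) / 2)"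
  by (simp add: tr_ptrace34[OF agree_op_carrier, symmetric] ptrace34_agree_op
      tr_smult[OF bell_mixture_carrier] tr_bell_mixture del: of_real_divide of_real_add)

lemma keep_prob_bell_mixture: "keep_prob (bell_mixture r) = (1 + r\<^sup>2) / 2"
  by (simp add: keep_prob_def agreeing_part_eq_agree_op[OF bell_mixture_carrier] tr_agree_op
      del: of_real_divide of_real_add)

lemma kept_state_bell_mixture: "kept_state (bell_mixture r) = bell_mixture (2 * r / (1 + r\<^sup>2))"
proof -
  have "0 < 1 + r\<^sup>2" by (simp add: add_pos_nonneg)
  then have "1 + r\<^sup>2 \<noteq> 0" by simp
  then have "1 / complex_of_real ((1 + r\<^sup>2) / 2) * complex_of_real ((1 + r\<^sup>2) / 2) = 1"
    by (simp del: of_real_divide of_real_add)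
  then show ?thesis
    unfolding kept_state_def agreeing_part_eq_agree_op[OF bell_mixture_carrier] tr_agree_op ptrace34_agree_op
    by (intro eq_matI) (simp_all add: mult.assoc[symmetric] del: of_real_divide of_real_add)
qed

lemma orthonormal_plus_minus: "orthonormal_basis2 ket_plus ket_minus"
proof -
  have d: "dim_vec ket_plus = 2" "dim_vec ket_minus = 2" by simp_all
  have s: "(\<Sum>i<2. f i) = f 0 + f 1" for f :: "nat \<Rightarrow> complex"
    by (simp add: lessThan_nat_numeral lessThan_Suc)
  show ?thesis
    unfolding orthonormal_basis2_def cscalar_prod_sum[OF d(1)] cscalar_prod_sum[OF d(2)] s
    using sqrt2_square by (auto intro!: carrier_vecI)
qed

lemma bell_mixture_in_two_kraus_states:
  assumes "0 \<le> r" "r \<le> 1"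
  shows "bell_mixture r \<in> two_kraus_states"
proof -
  have "density 4 (bell_mixture r)"
    unfolding density_def using psd_bell_mixture[OF assms] tr_bell_mixture by simp
  moreover have "(0::real) \<le> 0" "0 < 2 * pi" "cmod (complex_of_real r) \<le> 1"
    using assms by simp_all
  ultimately show ?thesis
    using orthonormal_plus_minus bell_mixture_two_kraus_state[of r, symmetric]
    unfolding two_kraus_states_def by blast
qed

section \<open>Local state preparation\<close>

lemma conjugate_add:
  fixes K :: "complex mat"
  assumes "K \<in> carrier_mat m n" "A \<in> carrier_mat n n" "B \<in> carrier_mat n n"
  shows "K * (A + B) * mat_adjoint K = K * A * mat_adjoint K + K * B * mat_adjoint K"
proof -
  have "K * (A + B) = K * A + K * B" by (rule mult_add_distrib_mat[OF assms])
  then show ?thesis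
    using add_mult_distrib_mat[OF _ _ mat_adjoint_carrier[OF assms(1)], of "K * A" m "K * B"] assms
    by simp
qed

lemma conjugate_smult:
  fixes K :: "complex mat"
  assumes "K \<in> carrier_mat m n" "A \<in> carrier_mat n n"
  shows "K * (c \<cdot>\<^sub>m A) * mat_adjoint K = c \<cdot>\<^sub>m (K * A * mat_adjoint K)"
proof -
  have "K * (c \<cdot>\<^sub>m A) = c \<cdot>\<^sub>m (K * A)" by (rule mult_smult_distrib[OF assms])
  then show ?thesis
    using mult_smult_assoc_mat[OF _ mat_adjoint_carrier[OF assms(1)], of "K * A" m c] assms
    by simp
qed

lemma ketbra_mult_vec:
  assumes "dim_vec y = dim_vec z"
  shows "ketbra x y *\<^sub>v z = (z \<bullet>c y) \<cdot>\<^sub>v x"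
proof (rule eq_vecI)
  fix i assume "i < dim_vec ((z \<bullet>c y) \<cdot>\<^sub>v x)"
  then show "(ketbra x y *\<^sub>v z) $ i = ((z \<bullet>c y) \<cdot>\<^sub>v x) $ i"
    using assms by (simp add: index_mult_mat_vec_sum cscalar_prod_sum[of _ "dim_vec y"] sum_distrib_left ac_simps
        del: index_mult_mat_vec)
qed simp

lemma orthonormal_basis2_flip:
  assumes "orthonormal_basis2 a a'"
  shows "a' \<bullet>c a = 0"
proof -
  have d: "dim_vec a = 2" "dim_vec a' = 2" using assms by (auto simp: orthonormal_basis2_def)
  have "a' \<bullet>c a = cnj (a \<bullet>c a')"
    unfolding cscalar_prod_sum[OF d(1)] cscalar_prod_sum[OF d(2)] by (simp add: mult.commute)
  then show ?thesis using assms by (simp add: orthonormal_basis2_def)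
qed

lemma prep_A_mult:
  assumes "orthonormal_basis2 a a'"
  shows "prep_A a a' *\<^sub>v a = ket_plus" "prep_A a a' *\<^sub>v a' = ket_minus"
proof -
  have d: "a \<in> carrier_vec 2" "a' \<in> carrier_vec 2" "dim_vec a = 2" "dim_vec a' = 2"
    using assms by (auto simp: orthonormal_basis2_def)
  have c: "ketbra ket_plus a \<in> carrier_mat 2 2" "ketbra ket_minus a' \<in> carrier_mat 2 2" using d by auto
  show "prep_A a a' *\<^sub>v a = ket_plus"
    unfolding prep_A_def add_mult_distrib_mat_vec[OF c d(1)] using assms d
    by (auto simp: ketbra_mult_vec orthonormal_basis2_def)
  show "prep_A a a' *\<^sub>v a' = ket_minus"
    unfolding prep_A_def add_mult_distrib_mat_vec[OF c d(2)] using assms d orthonormal_basis2_flip[OF assms]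
    by (auto simp: ketbra_mult_vec orthonormal_basis2_def)
qed

lemma smult_mat_mult_vec:
  "dim_col A = dim_vec v \<Longrightarrow> (k \<cdot>\<^sub>m A) *\<^sub>v v = k \<cdot>\<^sub>v (A *\<^sub>v v)" for k :: complex
  by (rule eq_vecI) (simp_all add: index_mult_mat_vec_sum sum_distrib_left mult.assoc del: index_mult_mat_vec)

lemma prep_B_mult:
  assumes "orthonormal_basis2 b b'"
  shows "prep_B b b' \<theta> *\<^sub>v b = ket_plus" "prep_B b b' \<theta> *\<^sub>v b' = cis (- \<theta>) \<cdot>\<^sub>v ket_minus"
proof -
  have d: "b \<in> carrier_vec 2" "b' \<in> carrier_vec 2" "dim_vec b = 2" "dim_vec b' = 2"
    using assms by (auto simp: orthonormal_basis2_def)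
  have c: "ketbra ket_plus b \<in> carrier_mat 2 2" "cis (- \<theta>) \<cdot>\<^sub>m ketbra ket_minus b' \<in> carrier_mat 2 2" using d by auto
  show "prep_B b b' \<theta> *\<^sub>v b = ket_plus"
    unfolding prep_B_def add_mult_distrib_mat_vec[OF c d(1)] using assms d
    by (auto simp: smult_mat_mult_vec ketbra_mult_vec orthonormal_basis2_def)
  show "prep_B b b' \<theta> *\<^sub>v b' = cis (- \<theta>) \<cdot>\<^sub>v ket_minus"
    unfolding prep_B_def add_mult_distrib_mat_vec[OF c d(2)]
    using assms d orthonormal_basis2_flip[OF assms]
    by (auto simp: smult_mat_mult_vec ketbra_mult_vec orthonormal_basis2_def)
qed

lemma tensor_vec_smult: "u \<otimes>\<^sub>v (c \<cdot>\<^sub>v v) = c \<cdot>\<^sub>v (u \<otimes>\<^sub>v v)"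
  by (rule eq_vecI) (auto simp: mod_less_of_less_mult)

text \<open>The phase of \<^term>\<open>prep_B\<close> turns the coherence of the state into the nonnegative real \<open>|R|\<close>.\<close>

lemma prepared_state_bell_mixture:
  assumes a: "orthonormal_basis2 a a'" and b: "orthonormal_basis2 b b'"
  shows "prepared_state a a' b b' \<alpha> R = bell_mixture (cmod R)"
proof -
  define \<theta> where "\<theta> = \<alpha> + Arg R"
  define U where "U = prep_A a a' \<otimes>\<^sub>m prep_B b b' \<theta>"
  have d: "dim_vec a = 2" "dim_vec a' = 2" "dim_vec b = 2" "dim_vec b' = 2"
    using a b by (auto simp: orthonormal_basis2_def)
  have dU: "dim_col (prep_A a a') = 2" "dim_col (prep_B b b' \<theta>) = 2"
    "dim_row (prep_A a a') = 2" "dim_row (prep_B b b' \<theta>) = 2"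
    using d by (simp_all add: prep_A_def prep_B_def)
  have Uc: "U \<in> carrier_mat 4 4" using dU by (auto simp: U_def)
  let ?v = "a \<otimes>\<^sub>v b" and ?v' = "a' \<otimes>\<^sub>v b'"
  let ?p = "ket_plus \<otimes>\<^sub>v ket_plus" and ?m = "ket_minus \<otimes>\<^sub>v ket_minus"
  let ?c = "cis (- \<alpha>) * cnj R" and ?c' = "cis \<alpha> * R"
  let ?e = "cis (- \<theta>)"
  have vc: "?v \<in> carrier_vec 4" "?v' \<in> carrier_vec 4" using d by (auto intro!: carrier_vecI)
  have Uv: "U *\<^sub>v ?v = ?p" "U *\<^sub>v ?v' = ?e \<cdot>\<^sub>v ?m"
    unfolding U_def using d dU
    by (simp_all add: tensor_mat_mult_tensor_vec prep_A_mult[OF a] prep_B_mult[OF b] tensor_vec_smult)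
  \<comment> \<open>The phase of \<open>cis \<alpha> * R\<close> is \<open>\<theta>\<close>, and the
    phase that \<open>prep_B\<close> attaches to \<open>b'\<close> cancels it.\<close>
  have R: "?c' * ?e = complex_of_real (cmod R)"
  proof -
    have "?c' * ?e = cis \<alpha> * (complex_of_real (cmod R) * cis (Arg R)) * cis (- \<theta>)"
      using rcis_cmod_Arg[of R] by (simp add: rcis_def)
    also have "\<dots> = complex_of_real (cmod R) * cis (\<alpha> + Arg R + - \<theta>)"
      by (simp add: cis_mult ac_simps del: cis_inverse)
    finally show ?thesis by (simp add: \<theta>_def)
  qed
  have R': "?c * cnj ?e = complex_of_real (cmod R)"
    using arg_cong[OF R, of cnj] by (simp add: cis_cnj)
  have e: "?e * cnj ?e = 1" by (simp add: cis_cnj cis_mult)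
  have kc: "ketbra x y \<in> carrier_mat 4 4" if "x \<in> {?v, ?v'}" "y \<in> {?v, ?v'}" for x y
    using that d by auto
  have "U * two_kraus_state a a' b b' \<alpha> R * mat_adjoint U =
     (1/2) \<cdot>\<^sub>m (ketbra ?p ?p + ?c \<cdot>\<^sub>m ketbra ?p (?e \<cdot>\<^sub>v ?m) + ?c' \<cdot>\<^sub>m ketbra (?e \<cdot>\<^sub>v ?m) ?p + ketbra (?e \<cdot>\<^sub>v ?m) (?e \<cdot>\<^sub>v ?m))"
    unfolding two_kraus_state_def
    by (simp add: conjugate_smult[OF Uc] conjugate_add[OF Uc] conjugate_ketbra[OF Uc] kc vc Uv add_carrier_mat)
  \<comment> \<open>This is the unfolded \<open>two_kraus_state\<close> with phase 0 and coherence
    \<open>|R|\<close>, hence the factors \<open>cis (- 0)\<close> and \<open>cis 0\<close>.\<close>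
  also have "\<dots> = (1/2) \<cdot>\<^sub>m (ketbra ?p ?p + (cis (- 0) * cnj (complex_of_real (cmod R))) \<cdot>\<^sub>m ketbra ?p ?m
      + (cis 0 * complex_of_real (cmod R)) \<cdot>\<^sub>m ketbra ?m ?p + ketbra ?m ?m)"
  proof -
    have 1: "?c \<cdot>\<^sub>m ketbra ?p (?e \<cdot>\<^sub>v ?m) = (?c * cnj ?e) \<cdot>\<^sub>m ketbra ?p ?m"
      by (rule eq_matI) (auto simp: ac_simps simp del: index_tensor_vec(1))
    have 2: "?c' \<cdot>\<^sub>m ketbra (?e \<cdot>\<^sub>v ?m) ?p = (?c' * ?e) \<cdot>\<^sub>m ketbra ?m ?p"
      by (rule eq_matI) (auto simp: ac_simps simp del: index_tensor_vec(1))
    have 3: "ketbra (?e \<cdot>\<^sub>v ?m) (?e \<cdot>\<^sub>v ?m) = (?e * cnj ?e) \<cdot>\<^sub>m ketbra ?m ?m"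
      by (rule eq_matI) (auto simp: ac_simps simp del: index_tensor_vec(1))
    have 4: "1 \<cdot>\<^sub>m ketbra ?m ?m = ketbra ?m ?m" by (rule eq_matI) auto
    show ?thesis unfolding 1 2 3 R R' e 4 by simp
  qed
  also have "\<dots> = bell_mixture (cmod R)"
    unfolding bell_mixture_two_kraus_state[symmetric] two_kraus_state_def ..
  finally show ?thesis
    unfolding prepared_state_def Let_def U_def \<theta>_def .
qed

text \<open>The upper bound is \<open>0 \<le> (1 - r)\<^sup>2\<close> rearranged.\<close>

lemma bell_parameter_bounds:
  fixes r :: real
  assumes "0 < r" "r \<le> 1"
  shows "0 < 2 * r / (1 + r\<^sup>2)" "2 * r / (1 + r\<^sup>2) \<le> 1"
proof -
  have p: "0 < 1 + r\<^sup>2" by (simp add: add_pos_nonneg)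
  show "0 < 2 * r / (1 + r\<^sup>2)" using assms p by simp
  have "0 \<le> (1 - r)\<^sup>2" by simp
  then show "2 * r / (1 + r\<^sup>2) \<le> 1" using p by (simp add: power2_diff)
qed

text \<open>The invariant of the algorithm: it starts at \<open>r = |R|\<close>, and every round
  keeps \<open>r\<close> in the half-open unit interval.\<close>

lemma pair_state_bell_mixture:
  assumes "orthonormal_basis2 a a'" "orthonormal_basis2 b b'" "0 < cmod R" "cmod R \<le> 1"
  shows "\<exists>r. 0 < r \<and> r \<le> 1 \<and> pair_state a a' b b' \<alpha> R k = bell_mixture r"
proof (induction k)
  case 0
  show ?case
    by (rule exI[of _ "cmod R"]) (use assms in \<open>simp add: prepared_state_bell_mixture\<close>)
next
  case (Suc k)
  then obtain r where "0 < r" "r \<le> 1" "pair_state a a' b b' \<alpha> R k = bell_mixture r" by blast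
  then show ?case
    using bell_parameter_bounds[of r] by (auto simp: kept_state_bell_mixture)
qed

section \<open>Attainment and optimality\<close>

lemma success_prob_agree_op: "success_prob agree_op (bell_mixture r) = (1 + r\<^sup>2) / 2"
  by (simp add: success_prob_def tr_agree_op del: of_real_divide of_real_add)

lemma output_fidelity_agree_op: "output_fidelity agree_op (bell_mixture r) = (1 + r)\<^sup>2 / (2 * (1 + r\<^sup>2))"
proof -
  have p: "0 < 1 + r\<^sup>2" by (simp add: add_pos_nonneg)
  have "output_fidelity agree_op (bell_mixture r) = fidelity (kept_state (bell_mixture r))"
    by (simp add: output_fidelity_def kept_state_def agreeing_part_eq_agree_op[OF bell_mixture_carrier])
  also have "\<dots> = (1 + 2 * r / (1 + r\<^sup>2)) / 2"
    by (simp add: kept_state_bell_mixture fidelity_bell_mixture)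
  also have "\<dots> = (1 + r)\<^sup>2 / (2 * (1 + r\<^sup>2))"
    using p by (simp add: field_simps power2_eq_square)
  finally show ?thesis .
qed

text \<open>Positivity makes the trace real and nonnegative, so the complex normalization becomes a
  real division, and a nonzero success probability is positive.\<close>

lemma output_fidelity_eq:
  assumes D: "distillation_op D" and r: "0 < r" "r \<le> 1"
  defines "X \<equiv> D (bell_mixture r \<otimes>\<^sub>m bell_mixture r)"
  shows "output_fidelity D (bell_mixture r) = fidelity (ptrace34 X) / success_prob D (bell_mixture r)"
    and "0 \<le> success_prob D (bell_mixture r)"
proof -
  have "psd 16 (bell_mixture r \<otimes>\<^sub>m bell_mixture r)"
    using r by (rule_tac psd_bell_mixture_tensor) simp_all
  then have X: "psd 16 X"
    using D completely_positive_psd by (auto simp: X_def distillation_op_def quantum_operation_def)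
  have t: "tr X = complex_of_real (success_prob D (bell_mixture r))"
    using psd_trace_real[OF X] by (simp add: success_prob_def X_def)
  have 1: "1 / tr X = complex_of_real (1 / success_prob D (bell_mixture r))"
    unfolding t by simp
  have "fidelity (complex_of_real c \<cdot>\<^sub>m M) = c * fidelity M" if "M \<in> carrier_mat 4 4" for c M
    using that by (simp add: fidelity_entries algebra_simps)
  from this[OF ptrace34_carrier]
  show "output_fidelity D (bell_mixture r) = fidelity (ptrace34 X) / success_prob D (bell_mixture r)"
    unfolding output_fidelity_def X_def[symmetric] 1 by (simp del: of_real_divide)
  have "psd 4 (ptrace34 X)" using X by (rule psd_ptrace34)
  from order_trans[OF fidelity_nonneg[OF this] fidelity_le_trace[OF this]]
  show "0 \<le> success_prob D (bell_mixture r)"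
    using tr_ptrace34[OF psd_carrier[OF X]] by (simp add: success_prob_def X_def)
qed

lemma max_of_eq:
  assumes "m \<in> X" "\<And>x. x \<in> X \<Longrightarrow> x \<le> m"
  shows "has_max X" "max_of X = m"
  using assms by (auto simp: has_max_def max_of_def intro!: Greatest_equality)

text \<open>\<open>agree_op\<close> attains both bounds of \<open>distillation_bounds\<close>. The
  second bound covers exactly the operations of optimal fidelity, so the maximal fidelity has to be
  identified first.\<close>

lemma bell_mixture_optimal:
  assumes r: "0 < r" "r \<le> 1"
  shows "has_max (fidelities (bell_mixture r))"
    and "optimal_fidelity (bell_mixture r) = (1 + r)\<^sup>2 / (2 * (1 + r\<^sup>2))"
    and "has_max (optimal_fidelity_probs (bell_mixture r))"
    and "optimal_prob (bell_mixture r) = (1 + r\<^sup>2) / 2"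
proof -
  let ?F = "(1 + r)\<^sup>2 / (2 * (1 + r\<^sup>2))"
  have p: "0 < 1 + r\<^sup>2" by (simp add: add_pos_nonneg)
  have s: "success_prob agree_op (bell_mixture r) \<noteq> 0"
    using p by (simp add: success_prob_agree_op)
  have bounds: "output_fidelity D (bell_mixture r) \<le> ?F"
    "output_fidelity D (bell_mixture r) = ?F \<Longrightarrow> success_prob D (bell_mixture r) \<le> (1 + r\<^sup>2) / 2"
    if D: "distillation_op D" and nz: "success_prob D (bell_mixture r) \<noteq> 0" for D
  proof -
    let ?T = "success_prob D (bell_mixture r)"
    let ?f = "fidelity (ptrace34 (D (bell_mixture r \<otimes>\<^sub>m bell_mixture r)))"
    have T: "0 < ?T" using output_fidelity_eq(2)[OF D r] nz by simp
    note b = distillation_bounds[OF D r, folded success_prob_def]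
    show "output_fidelity D (bell_mixture r) \<le> ?F"
      unfolding output_fidelity_eq(1)[OF D r]
      using b(1) T p by (simp add: field_simps)
    assume "output_fidelity D (bell_mixture r) = ?F"
    then have "?f / ?T = ?F" unfolding output_fidelity_eq(1)[OF D r] .
    then have "?f * (2 * (1 + r\<^sup>2)) = (1 + r)\<^sup>2 * ?T"
      using T p by (simp add: frac_eq_eq)
    then show "?T \<le> (1 + r\<^sup>2) / 2" by (rule b(2))
  qed
  have "?F \<in> fidelities (bell_mixture r)"
    using distillation_op_agree_op s output_fidelity_agree_op[of r] unfolding fidelities_def by force
  from max_of_eq[OF this]
  have F: "has_max (fidelities (bell_mixture r))" "max_of (fidelities (bell_mixture r)) = ?F"
    using bounds(1) by (auto simp: fidelities_def)
  show "has_max (fidelities (bell_mixture r))" by (rule F(1))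
  show opt: "optimal_fidelity (bell_mixture r) = ?F" using F(2) by (simp add: optimal_fidelity_def)
  have "(1 + r\<^sup>2) / 2 \<in> optimal_fidelity_probs (bell_mixture r)"
    using distillation_op_agree_op s output_fidelity_agree_op[of r] success_prob_agree_op[of r]
    unfolding optimal_fidelity_probs_def opt by force
  from max_of_eq[OF this]
  have P: "has_max (optimal_fidelity_probs (bell_mixture r))"
    "max_of (optimal_fidelity_probs (bell_mixture r)) = (1 + r\<^sup>2) / 2"
    using bounds(2) unfolding optimal_fidelity_probs_def opt by blast+
  show "has_max (optimal_fidelity_probs (bell_mixture r))" by (rule P(1))
  show "optimal_prob (bell_mixture r) = (1 + r\<^sup>2) / 2" using P(2) by (simp add: optimal_prob_def)
qed

theorem mainTheorem4:
  fixes a a' b b' :: "complex vec" and \<alpha> :: real and R :: complex and k :: nat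
  assumes "orthonormal_basis2 a a'"
    and "orthonormal_basis2 b b'"
    and "0 \<le> \<alpha>" and "\<alpha> < 2 * pi"
    and "0 < cmod R" and "cmod R \<le> 1"
    and "1 \<le> k"
  shows "pair_state a a' b b' \<alpha> R (k - 1) \<in> two_kraus_states \<and>
         has_max (fidelities (pair_state a a' b b' \<alpha> R (k - 1))) \<and>
         round_fidelity a a' b b' \<alpha> R k = optimal_fidelity (pair_state a a' b b' \<alpha> R (k - 1)) \<and>
         has_max (optimal_fidelity_probs (pair_state a a' b b' \<alpha> R (k - 1))) \<and>
         round_prob a a' b b' \<alpha> R k = optimal_prob (pair_state a a' b b' \<alpha> R (k - 1))"
proof -
  obtain r where r: "0 < r" "r \<le> 1" and pair: "pair_state a a' b b' \<alpha> R (k - 1) = bell_mixture r"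
    using pair_state_bell_mixture assms by blast
  have "pair_state a a' b b' \<alpha> R k = kept_state (bell_mixture r)"
    using \<open>1 \<le> k\<close> pair by (cases k) auto
  \<comment> \<open>A kept pair is the normalized output of \<open>agree_op\<close>, so the round is
    itself one of the distillation operations.\<close>
  then have "round_fidelity a a' b b' \<alpha> R k = output_fidelity agree_op (bell_mixture r)"
    by (simp add: round_fidelity_def output_fidelity_def kept_state_def
        agreeing_part_eq_agree_op[OF bell_mixture_carrier])
  then show ?thesis
    unfolding pair round_prob_def
    using r bell_mixture_optimal[OF r] bell_mixture_in_two_kraus_states[of r]
    by (simp add: keep_prob_bell_mixture output_fidelity_agree_op)
qed

end
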